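(* Let $(X,T)$ be a topological dynamical system such that the entropy map $\mu\mapsto h_\mu(T)$ is upper semi-continuous on $\mathcal{M}(X,T)$ and the topological entropy satisfies $h_{top}(T)<\infty$. Let $\Phi=\{\log\phi_n\}_{n=1}^\infty$ be a subadditive potential on $X$ with $\beta(\Phi)>-\infty$. For each $t>0$ let $\mu_t$ be an equilibrium measure for the potential $t\Phi$. Then any weak$^*$ accumulation point $\mu$ of the family $(\mu_t)_{t>0}$ as $t\to\infty$ is a Lyapunov maximizing measure for $\Phi$, i.e. $\mu\in\mathcal{M}_{\max}(\Phi)$. Moreover, for any such $\mu$: (i) $\chi(\mu,\Phi)=\lim_{t\to\infty}\chi(\mu_t,\Phi)$; (ii) $h_\mu(T)=\lim_{t\to\infty}h_{\mu_t}(T)=\max\{h_\nu(T):\nu\in\mathcal{M}_{\max}(\Phi)\}$. Furthermore, $\beta(\Phi)$ can be approximated by Lyapunov exponents of equilibrium measures of the potentials $t\Phi$: for every $\varepsilon>0$ there exist $t>0$ and an equilibrium measure $\nu_t$ for $t\Phi$ such that $|\chi(\nu_t,\Phi)-\beta(\Phi)|<\varepsilon$.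
   Context: A topological dynamical system $(X,T)$ is a compact metric space $(X,d)$ with a continuous map $T:X\to X$. $\mathcal{M}(X,T)$ is the set of $T$-invariant Borel probability measures on $X$ with the weak$^*$ topology, and $h_\mu(T)$ is the metric (Kolmogorov–Sinai) entropy of $\mu\in\mathcal{M}(X,T)$. A subadditive potential is a sequence $\Phi=\{\log\phi_n\}_{n=1}^\infty$ where each $\phi_n:X\to[0,\infty)$ is continuous and $0\le\phi_{n+m}(x)\le\phi_n(x)\,\phi_m(T^n(x))$ for all $x\in X$ and all $m,n\ge 1$ (with $\log 0=-\infty$). For $t>0$, $t\Phi=\{t\log\phi_n\}_{n=1}^\infty$, which is the subadditive potential given by the functions $\phi_n^t$. For $\mu\in\mathcal{M}(X,T)$ the Lyapunov exponent is $\chi(\mu,\Phi)=\lim_{n\to\infty}\frac1n\int\log\phi_n\,d\mu\in[-\infty,\infty)$. The maximal Lyapunov exponent is $\beta(\Phi)=\lim_{n\to\infty}\frac1n\log\sup_{x\in X}\phi_n(x)$. The set of (Lyapunov) maximizing measures is $\mathcal{M}_{\max}(\Phi)=\{\mu\in\mathcal{M}(X,T):\chi(\mu,\Phi)=\beta(\Phi)\}$. Topological pressure: let $d_n(x,y)=\max_{0\le k\le n-1}d(T^kx,T^ky)$; a set $E\subset X$ is $(n,\varepsilon)$-separated if $d_n(x,y)>\varepsilon$ for all distinct $x,y\in E$. For a subadditive potential $\Psi=\{\log\psi_n\}_{n=1}^\infty$ put $P_n(T,\Psi,\varepsilon)=\sup\{\sum_{x\in E}\psi_n(x): E \text{ is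 } (n,\varepsilon)\text{-separated}\}$, $P(T,\Psi,\varepsilon)=\limsup_{n\to\infty}\frac1n\log P_n(T,\Psi,\varepsilon)$ and $P(T,\Psi)=\lim_{\varepsilon\to0}P(T,\Psi,\varepsilon)$. The topological entropy $h_{top}(T)$ is the pressure of the potential with $\psi_n\equiv1$ for all $n$. Write $P(t)=P(T,t\Phi)$. For $t>0$, an equilibrium measure (equilibrium state) for $t\Phi$ is a measure $\mu\in\mathcal{M}(X,T)$ with $h_\mu(T)+t\,\chi(\mu,\Phi)=P(t)$. (Under the hypotheses of the theorem, equilibrium measures for $t\Phi$ exist for every $t>0$.) *)

theory Defs
  imports "HOL-Probability.Probability"
begin

section \<open>Invariant measures and the weak* topology\<close>

definition invariant_measures :: "('a::metric_space \<Rightarrow> 'a) \<Rightarrow> 'a measure set" where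
  "invariant_measures T =
     {\<mu>. prob_space \<mu> \<and> sets \<mu> = sets borel \<and> distr \<mu> borel T = \<mu>}"

text \<open>The coarsest topology on the invariant measures for which
  \<open>\<mu> \<mapsto> \<integral>f d\<mu>\<close> is continuous for every continuous real-valued \<open>f\<close>
  (all such \<open>f\<close> are bounded, the space being compact).\<close>

definition weak_star_topology :: "('a::metric_space \<Rightarrow> 'a) \<Rightarrow> 'a measure topology" where
  "weak_star_topology T =
     topology_generated_by
       {{\<mu> \<in> invariant_measures T. (\<integral>x. f x \<partial>\<mu>) \<in> U} | f U.
          continuous_on UNIV (f :: 'a \<Rightarrow> real) \<and> open U}"

text \<open>Every neighbourhood of the point contains \<open>m t\<close> for arbitrarily large \<open>t\<close>.\<close>

definition accumulation_point_at_top :: "'b topology \<Rightarrow> (real \<Rightarrow> 'b) \<Rightarrow> 'b \<Rightarrow> bool" where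
  "accumulation_point_at_top X m l \<longleftrightarrow>
     l \<in> topspace X \<and> (\<forall>U. openin X U \<and> l \<in> U \<longrightarrow> (\<exists>\<^sub>F t in at_top. m t \<in> U))"

definition upper_semicontinuous_map :: "'b topology \<Rightarrow> ('b \<Rightarrow> ereal) \<Rightarrow> bool" where
  "upper_semicontinuous_map X f \<longleftrightarrow> (\<forall>a. openin X {x \<in> topspace X. f x < a})"

section \<open>Kolmogorov--Sinai entropy\<close>

definition partition_entropy :: "'a measure \<Rightarrow> 'a set set \<Rightarrow> real" where
  "partition_entropy \<mu> P = - (\<Sum>A\<in>P. measure \<mu> A * ln (measure \<mu> A))"

text \<open>The join of \<open>P, T\<^sup>-\<^sup>1 P, \<dots>, T\<^sup>-\<^sup>(\<^sup>n\<^sup>-\<^sup>1\<^sup>) P\<close>, empty cells discarded.\<close>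

definition iterated_join :: "('a \<Rightarrow> 'a) \<Rightarrow> 'a set set \<Rightarrow> nat \<Rightarrow> 'a set set" where
  "iterated_join T P n =
     {\<Inter>k<n. (T ^^ k) -` a k | a. \<forall>k<n. a k \<in> P} - {{}}"

definition partition_entropy_rate :: "('a \<Rightarrow> 'a) \<Rightarrow> 'a measure \<Rightarrow> 'a set set \<Rightarrow> real" where
  "partition_entropy_rate T \<mu> P = lim (\<lambda>n. partition_entropy \<mu> (iterated_join T P n) / real n)"

definition ks_entropy :: "('a \<Rightarrow> 'a) \<Rightarrow> 'a measure \<Rightarrow> ereal" where
  "ks_entropy T \<mu> =
     (SUP P\<in>{P. finite P \<and> P \<subseteq> sets \<mu> \<and> partition_on (space \<mu>) P}.
        ereal (partition_entropy_rate T \<mu> P))"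

section \<open>Subadditive potentials\<close>

text \<open>A potential \<open>{log \<phi>\<^sub>n}\<close> is represented by the functions \<open>\<phi>\<^sub>n\<close>, \<open>n \<ge> 1\<close>; the value
  at index \<open>0\<close> is irrelevant.\<close>

definition subadditive_potential :: "('a::metric_space \<Rightarrow> 'a) \<Rightarrow> (nat \<Rightarrow> 'a \<Rightarrow> real) \<Rightarrow> bool" where
  "subadditive_potential T \<phi> \<longleftrightarrow>
     (\<forall>n\<ge>1. continuous_on UNIV (\<phi> n) \<and> (\<forall>x. 0 \<le> \<phi> n x)) \<and>
     (\<forall>n\<ge>1. \<forall>m\<ge>1. \<forall>x. \<phi> (n + m) x \<le> \<phi> n x * \<phi> m ((T ^^ n) x))"

definition scaled_potential :: "real \<Rightarrow> (nat \<Rightarrow> 'a \<Rightarrow> real) \<Rightarrow> nat \<Rightarrow> 'a \<Rightarrow> real" where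
  "scaled_potential t \<phi> = (\<lambda>n x. \<phi> n x powr t)"

text \<open>The logarithm on \<open>[0,\<infinity>]\<close>, with \<open>log 0 = -\<infinity>\<close>; the real \<^const>\<open>ln\<close> has \<open>ln 0 = 0\<close>.\<close>

definition ereal_log :: "ereal \<Rightarrow> ereal" where
  "ereal_log x =
     (if x \<le> 0 then -\<infinity> else if x = \<infinity> then \<infinity> else ereal (ln (real_of_ereal x)))"

text \<open>Positive part minus negative part; only used where the positive part has finite integral.\<close>

definition ereal_integral :: "'a measure \<Rightarrow> ('a \<Rightarrow> ereal) \<Rightarrow> ereal" where
  "ereal_integral \<mu> f =
     enn2ereal (\<integral>\<^sup>+x. e2ennreal (f x) \<partial>\<mu>) - enn2ereal (\<integral>\<^sup>+x. e2ennreal (- f x) \<partial>\<mu>)"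

definition lyapunov_exponent :: "'a measure \<Rightarrow> (nat \<Rightarrow> 'a \<Rightarrow> real) \<Rightarrow> ereal" where
  "lyapunov_exponent \<mu> \<phi> =
     lim (\<lambda>n. ereal (1 / real n) * ereal_integral \<mu> (\<lambda>x. ereal_log (ereal (\<phi> n x))))"

definition maximal_lyapunov_exponent :: "(nat \<Rightarrow> 'a \<Rightarrow> real) \<Rightarrow> ereal" where
  "maximal_lyapunov_exponent \<phi> =
     lim (\<lambda>n. ereal (1 / real n) * ereal_log (SUP x. ereal (\<phi> n x)))"

definition maximizing_measures ::
  "('a::metric_space \<Rightarrow> 'a) \<Rightarrow> (nat \<Rightarrow> 'a \<Rightarrow> real) \<Rightarrow> 'a measure set" where
  "maximizing_measures T \<phi> =
     {\<mu> \<in> invariant_measures T. lyapunov_exponent \<mu> \<phi> = maximal_lyapunov_exponent \<phi>}"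

section \<open>Topological pressure\<close>

definition bowen_dist :: "('a::metric_space \<Rightarrow> 'a) \<Rightarrow> nat \<Rightarrow> 'a \<Rightarrow> 'a \<Rightarrow> real" where
  "bowen_dist T n x y = (MAX k\<in>{..<n}. dist ((T ^^ k) x) ((T ^^ k) y))"

definition separated :: "('a::metric_space \<Rightarrow> 'a) \<Rightarrow> nat \<Rightarrow> real \<Rightarrow> 'a set \<Rightarrow> bool" where
  "separated T n \<epsilon> E \<longleftrightarrow> (\<forall>x\<in>E. \<forall>y\<in>E. x \<noteq> y \<longrightarrow> bowen_dist T n x y > \<epsilon>)"

text \<open>Requiring \<^term>\<open>finite E\<close> is no restriction: on a compact space, separated sets for a
  continuous \<open>T\<close> and \<open>n \<ge> 1\<close>, \<open>\<epsilon> > 0\<close> are finite.\<close>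

definition separated_sum ::
  "('a::metric_space \<Rightarrow> 'a) \<Rightarrow> (nat \<Rightarrow> 'a \<Rightarrow> real) \<Rightarrow> real \<Rightarrow> nat \<Rightarrow> ereal" where
  "separated_sum T \<psi> \<epsilon> n =
     (SUP E\<in>{E. finite E \<and> separated T n \<epsilon> E}. ereal (\<Sum>x\<in>E. \<psi> n x))"

definition pressure_at_scale ::
  "('a::metric_space \<Rightarrow> 'a) \<Rightarrow> (nat \<Rightarrow> 'a \<Rightarrow> real) \<Rightarrow> real \<Rightarrow> ereal" where
  "pressure_at_scale T \<psi> \<epsilon> =
     limsup (\<lambda>n. ereal (1 / real n) * ereal_log (separated_sum T \<psi> \<epsilon> n))"

definition pressure :: "('a::metric_space \<Rightarrow> 'a) \<Rightarrow> (nat \<Rightarrow> 'a \<Rightarrow> real) \<Rightarrow> ereal" where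
  "pressure T \<psi> = Lim (at_right 0) (pressure_at_scale T \<psi>)"

definition topological_entropy :: "('a::metric_space \<Rightarrow> 'a) \<Rightarrow> ereal" where
  "topological_entropy T = pressure T (\<lambda>n x. 1)"

definition equilibrium_measure ::
  "('a::metric_space \<Rightarrow> 'a) \<Rightarrow> (nat \<Rightarrow> 'a \<Rightarrow> real) \<Rightarrow> real \<Rightarrow> 'a measure \<Rightarrow> bool" where
  "equilibrium_measure T \<phi> t \<mu> \<longleftrightarrow>
     \<mu> \<in> invariant_measures T \<and>
     ks_entropy T \<mu> + ereal t * lyapunov_exponent \<mu> \<phi> = pressure T (scaled_potential t \<phi>)"

end

(* Evaluating P_n on singletons gives P(t) >= t beta, and h_top < infinity gives P(t) < infinity.
   Together with the inequality h_nu + t chi(nu) <= P(t) for every invariant nu with finite exponent,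
   the equilibrium states mu_t maximise nu |-> h_nu + t chi(nu).  Comparing mu_s with mu_t shows that
   h(mu_t) is nonincreasing in t, so beta - h(mu_1)/t <= chi(mu_t) <= beta for t >= 1, and h(mu_t) >= h_nu for
   every maximizing nu.  Upper semicontinuity of chi (an infimum of integrals of upper semicontinuous
   functions) and of the entropy then passes both facts to accumulation points; monotonicity of
   h(mu_t) upgrades convergence along a subnet to a full limit.

   The inequality h_nu + t chi(nu) <= P(t) follows Misiurewicz: replace the cells of a partition joined
   over N steps by closed cores, leaving a set B0 of small measure, and record along an orbit the
   cell and whether the orbit is in B0.  Weighting a visit to B0 by 1/K, K being the number of
   cells, each Bowen ball carries total weight at most 2^n, so Gibbs' inequality and a greedy choice of
   separated points bound the entropy by P_n up to n (log 2 + 1), an error of order 1/N per step. *)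

theory Submission
  imports Defs
begin

section \<open>Subadditive sequences and finite inequalities\<close>

text \<open>The obstacle is the absence of any distortion bound: on a small Bowen ball the values of
  \<open>\<phi> n\<close> are not comparable, and \<open>\<phi> n\<close> may vanish. So no step
  transfers a value of the potential from one point to a nearby one. Each itinerary class of
  positive measure is represented by a point of its own where the logarithm is at least its
  conditional mean minus 1, and separated points are selected in decreasing order of value, so that
  a discarded neighbour never exceeds the point that discards it. The weights 1/K play the part of
  the conditional entropy of the partition given its closed cores, and of counting the classes that
  meet a ball. The iterate \<open>T ^^ N\<close> serves only to read labels block by block; entropy
  and pressure are those of \<open>T\<close> along the multiples of N, so no power rule for either
  enters. Exponents may be -inf, while the real \<open>ln\<close> has \<open>ln 0 = 0\<close>; hence
  the extended logarithm is used until a finite exponent gives positivity almost everywhere.\<close>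

lemma subadditive_iterate:
  fixes a :: "nat \<Rightarrow> ereal"
  assumes sub: "\<And>m n. m \<ge> 1 \<Longrightarrow> n \<ge> 1 \<Longrightarrow> a (m + n) \<le> a m + a n"
    and n: "n \<ge> 1" "a n \<le> ereal (c * real n)" and r: "r \<ge> 1"
  shows "a (q * n + r) \<le> ereal (c * real n * real q) + a r"
proof (induction q)
  case (Suc q)
  have "a (n + (q * n + r)) \<le> a n + a (q * n + r)"
    using sub n r by simp
  also have "\<dots> \<le> ereal (c * real n) + (ereal (c * real n * real q) + a r)"
    by (intro add_mono n Suc)
  also have "\<dots> = ereal (c * real n * real (Suc q)) + a r"
    by (simp add: algebra_simps flip: add.assoc)
  finally show ?case by (simp add: algebra_simps)
qed (simp flip: zero_ereal_def)

lemma fekete_ereal: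
  fixes a :: "nat \<Rightarrow> ereal"
  assumes fin: "\<And>n. n \<ge> 1 \<Longrightarrow> a n < \<infinity>"
    and sub: "\<And>m n. m \<ge> 1 \<Longrightarrow> n \<ge> 1 \<Longrightarrow> a (m + n) \<le> a m + a n"
  shows "(\<lambda>n. ereal (1 / real n) * a n) \<longlonglongrightarrow> (INF n\<in>{1..}. ereal (1 / real n) * a n)"
    (is "_ \<longlonglongrightarrow> ?L")
proof (rule order_tendstoI)
  fix l assume "l < ?L"
  then have "l < ereal (1 / real n) * a n" if "n \<ge> 1" for n
    using that by (auto intro: less_le_trans[OF _ INF_lower])
  then show "eventually (\<lambda>n. l < ereal (1 / real n) * a n) sequentially"
    by (rule eventually_sequentiallyI[of 1])
next
  fix u assume "?L < u"
  then obtain n where n: "n \<ge> 1" "ereal (1 / real n) * a n < u"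
    by (auto simp: INF_less_iff)
  \<comment> \<open>\<open>c1\<close> is a real bound for a quotient that may be -inf; the gap up to
    \<open>c2\<close> will absorb an error of order 1/m.\<close>
  obtain c1 where c1: "ereal (1 / real n) * a n < ereal c1" "ereal c1 < u"
    using ereal_dense3[OF n(2)] by auto
  obtain c2 where c2: "c1 < c2" "ereal c2 < u"
    using ereal_dense3[OF c1(2)] by auto
  have an: "a n \<le> ereal (c1 * real n)"
    using c1(1) n(1) by (cases "a n") (auto simp: field_simps)
  define K where "K = Max ((\<lambda>r. real_of_ereal (a r)) ` {1..n})"
  have aK: "a r \<le> ereal K" if "r \<in> {1..n}" for r
  proof -
    have "real_of_ereal (a r) \<le> K" unfolding K_def using that by (intro Max_ge) auto
    then show ?thesis using fin[of r] that by (cases "a r") auto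
  qed
  have bound: "ereal (1 / real m) * a m \<le> ereal (c1 + (K + \<bar>c1\<bar> * real n) * (1 / real m))" if m: "m \<ge> 1" for m
  proof -
    \<comment> \<open>Dividing m - 1 instead of m puts the remainder into {1..n}: subadditivity says
      nothing about the index 0.\<close>
    define q r where "q = (m - 1) div n" and "r = (m - 1) mod n + 1"
    have r: "r \<in> {1..n}" using n(1) unfolding r_def by (auto simp: Suc_le_eq)
    have qm: "q * n + r = m"
      using div_mult_mod_eq[of "m - 1" n] m unfolding q_def r_def by linarith
    have "a m \<le> ereal (c1 * real n * real q) + a r"
      using subadditive_iterate[OF sub n(1) an, where q = q and r = r] qm r by auto
    also have "\<dots> \<le> ereal (c1 * real n * real q) + ereal K"
      using aK[OF r] by (intro add_left_mono)
    finally have am: "a m \<le> ereal (c1 * real n * real q + K)" by simp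
    have "real m = real q * real n + real r" using qm by (metis of_nat_add of_nat_mult)
    then have "c1 * real n * real q + K = c1 * real m + (K - c1 * real r)"
      by (simp add: algebra_simps)
    also have "\<dots> \<le> c1 * real m + (K + \<bar>c1\<bar> * real n)"
    proof -
      have "- c1 * real r \<le> \<bar>c1\<bar> * real r" by (intro mult_right_mono) auto
      also have "\<dots> \<le> \<bar>c1\<bar> * real n" using r by (intro mult_left_mono) auto
      finally show ?thesis by simp
    qed
    finally have "a m \<le> ereal (c1 * real m + (K + \<bar>c1\<bar> * real n))"
      using am by (metis order_trans ereal_less_eq(3))
    then have "ereal (1 / real m) * a m \<le> ereal (1 / real m) * ereal (c1 * real m + (K + \<bar>c1\<bar> * real n))"
      by (intro ereal_mult_left_mono) auto
    also have "\<dots> = ereal (c1 + (K + \<bar>c1\<bar> * real n) * (1 / real m))"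
      using m by (simp add: field_simps)
    finally show ?thesis .
  qed
  have "(\<lambda>m. c1 + (K + \<bar>c1\<bar> * real n) * (1 / real m)) \<longlonglongrightarrow> c1 + (K + \<bar>c1\<bar> * real n) * 0"
    by (intro tendsto_intros lim_1_over_n)
  then have "eventually (\<lambda>m. c1 + (K + \<bar>c1\<bar> * real n) * (1 / real m) < c2) sequentially"
    using c2(1) by (intro order_tendstoD(2)) auto
  then show "eventually (\<lambda>m. ereal (1 / real m) * a m < u) sequentially"
    using eventually_ge_at_top[of 1]
  proof eventually_elim
    case (elim m)
    have "ereal (1 / real m) * a m < ereal c2"
      using bound[OF elim(2)] elim(1) by (metis ereal_less(2) le_less_trans less_ereal.simps(1))
    then show ?case using c2(2) by (rule less_trans)
  qed
qed

lemma fekete_nonneg: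
  fixes a :: "nat \<Rightarrow> real"
  assumes nonneg: "\<And>n. 0 \<le> a n"
    and sub: "\<And>m n. m \<ge> 1 \<Longrightarrow> n \<ge> 1 \<Longrightarrow> a (m + n) \<le> a m + a n"
  shows "convergent (\<lambda>n. a n / real n)"
proof -
  let ?L = "INF n\<in>{1..}. ereal (1 / real n) * ereal (a n)"
  have lim: "(\<lambda>n. ereal (1 / real n) * ereal (a n)) \<longlonglongrightarrow> ?L"
    using sub by (intro fekete_ereal) auto
  have "0 \<le> ?L" using nonneg by (intro INF_greatest) auto
  moreover have "?L \<le> ereal (1 / real 1) * ereal (a 1)" by (intro INF_lower) auto
  ultimately obtain l where "?L = ereal l" by (cases ?L) auto
  then show ?thesis using lim by (auto simp: convergent_def)
qed

text \<open>Nonnegativity of relative entropy with respect to the normalised weights q i / Q, from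
  ln x \<le> x - 1.\<close>

lemma gibbs_inequality:
  fixes p q :: "'i \<Rightarrow> real"
  assumes "finite F" and p: "\<And>i. i \<in> F \<Longrightarrow> p i > 0" and q: "\<And>i. i \<in> F \<Longrightarrow> q i > 0"
    and one: "(\<Sum>i\<in>F. p i) = 1"
  shows "(\<Sum>i\<in>F. p i * (ln (q i) - ln (p i))) \<le> ln (\<Sum>i\<in>F. q i)"
proof -
  define Q where "Q = (\<Sum>i\<in>F. q i)"
  have "F \<noteq> {}" using one by auto
  then have Q: "Q > 0" unfolding Q_def using assms by (intro sum_pos) auto
  have "(\<Sum>i\<in>F. p i * (ln (q i) - ln (p i))) - ln Q = (\<Sum>i\<in>F. p i * (ln (q i) - ln (p i))) - (\<Sum>i\<in>F. p i) * ln Q"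
    using one by simp
  also have "\<dots> = (\<Sum>i\<in>F. p i * (ln (q i) - ln (p i) - ln Q))"
    by (simp add: sum_distrib_right right_diff_distrib flip: sum_subtractf)
  also have "\<dots> \<le> (\<Sum>i\<in>F. q i / Q - p i)"
  proof (rule sum_mono)
    fix i assume i: "i \<in> F"
    have "ln (q i) - ln (p i) - ln Q = ln (q i / (p i * Q))"
      using p[OF i] q[OF i] Q by (simp add: ln_div ln_mult)
    also have "\<dots> \<le> q i / (p i * Q) - 1"
      using p[OF i] q[OF i] Q by (intro ln_le_minus_one) auto
    finally have "p i * (ln (q i) - ln (p i) - ln Q) \<le> p i * (q i / (p i * Q) - 1)"
      using p[OF i] by (intro mult_left_mono) auto
    also have "\<dots> = q i / Q - p i" using p[OF i] Q by (simp add: field_simps)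
    finally show "p i * (ln (q i) - ln (p i) - ln Q) \<le> q i / Q - p i" .
  qed
  also have "\<dots> = 0" using one Q by (simp add: sum_subtractf Q_def flip: sum_divide_distrib)
  finally show ?thesis by (simp add: Q_def)
qed

text \<open>Choose an index of maximal value, discard its neighbours, and repeat.\<close>

lemma greedy_independent_subset:
  fixes v w :: "'i \<Rightarrow> real"
  assumes "finite F" and "\<And>i. i \<in> F \<Longrightarrow> v i \<ge> 0" and "\<And>i. i \<in> F \<Longrightarrow> w i \<ge> 0"
    and refl: "\<And>i. near i i" and sym: "\<And>i j. near i j \<Longrightarrow> near j i"
    and W: "\<And>j. j \<in> F \<Longrightarrow> (\<Sum>i\<in>{i\<in>F. near j i}. w i) \<le> W"
  shows "\<exists>E\<subseteq>F. (\<forall>i\<in>E. \<forall>j\<in>E. i \<noteq> j \<longrightarrow> \<not> near i j) \<and> (\<Sum>i\<in>F. w i * v i) \<le> W * (\<Sum>i\<in>E. v i)"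
  using assms(1-3) W
proof (induction "card F" arbitrary: F rule: less_induct)
  case less
  show ?case
  proof (cases "F = {}")
    case False
    have "finite (v ` F)" "v ` F \<noteq> {}" using False less.prems by auto
    then have "Max (v ` F) \<in> v ` F" by (rule Max_in)
    then obtain j where j: "j \<in> F" "v j = Max (v ` F)" by auto
    have vj: "v i \<le> v j" if "i \<in> F" for i
      using that less.prems(1) by (simp add: j(2))
    define G where "G = {i\<in>F. near j i}"
    have G: "G \<subseteq> F" "j \<in> G" "finite G" using j refl less.prems(1) by (auto simp: G_def)
    have "card (F - G) < card F" using G j less.prems(1) by (intro psubset_card_mono) auto
    then have "\<exists>E\<subseteq>F - G. (\<forall>i\<in>E. \<forall>j\<in>E. i \<noteq> j \<longrightarrow> \<not> near i j) \<and>
        (\<Sum>i\<in>F - G. w i * v i) \<le> W * (\<Sum>i\<in>E. v i)"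
    proof (rule less.hyps)
      fix k assume k: "k \<in> F - G"
      have "sum w {i \<in> F - G. near k i} \<le> sum w {i \<in> F. near k i}"
        using less.prems by (intro sum_mono2) auto
      then show "sum w {i \<in> F - G. near k i} \<le> W" using less.prems(4)[of k] k by auto
    qed (use less.prems in auto)
    then obtain E where E: "E \<subseteq> F - G" "\<forall>i\<in>E. \<forall>j\<in>E. i \<noteq> j \<longrightarrow> \<not> near i j"
      "(\<Sum>i\<in>F - G. w i * v i) \<le> W * (\<Sum>i\<in>E. v i)" by blast
    have "(\<Sum>i\<in>G. w i * v i) \<le> (\<Sum>i\<in>G. w i * v j)"
      using less.prems vj G by (intro sum_mono mult_left_mono) auto
    also have "\<dots> = (\<Sum>i\<in>G. w i) * v j" by (simp add: sum_distrib_right)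
    also have "\<dots> \<le> W * v j"
      using less.prems(4)[OF j(1)] less.prems(2)[OF j(1)] by (intro mult_right_mono) (auto simp: G_def)
    finally have le: "(\<Sum>i\<in>G. w i * v i) \<le> W * v j" .
    have fE: "finite E" "j \<notin> E"
      using E(1) G(2) finite_subset[OF E(1)] less.prems(1) by auto
    have "(\<Sum>i\<in>F. w i * v i) = (\<Sum>i\<in>F - G. w i * v i) + (\<Sum>i\<in>G. w i * v i)"
      using G less.prems(1) by (intro sum.subset_diff) auto
    also have "\<dots> \<le> W * (\<Sum>i\<in>insert j E. v i)"
      using E(3) le fE by (simp add: algebra_simps)
    finally have sum: "(\<Sum>i\<in>F. w i * v i) \<le> W * (\<Sum>i\<in>insert j E. v i)" .
    have "\<not> near i k" if "i \<in> insert j E" "k \<in> insert j E" "i \<noteq> k" for i k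
    proof -
      have "\<not> near j k'" if "k' \<in> E" for k' using that E(1) by (auto simp: G_def)
      then show ?thesis using that E(2) sym by blast
    qed
    moreover have "insert j E \<subseteq> F" using E(1) j(1) by auto
    ultimately show ?thesis using sum by blast
  qed simp
qed

section \<open>The extended logarithm and the dependence of pressure on the scale\<close>

lemma ereal_log_mono: "x \<le> y \<Longrightarrow> ereal_log x \<le> ereal_log y"
  unfolding ereal_log_def by (cases x; cases y) (auto simp: zero_ereal_def)

lemma ereal_log_real: "x > 0 \<Longrightarrow> ereal_log (ereal x) = ereal (ln x)"
  unfolding ereal_log_def by (simp add: zero_ereal_def)

lemma ereal_log_mult:
  assumes "c > 0" "0 \<le> x"
  shows "ereal_log (ereal c * x) = ereal (ln c) + ereal_log x"
  using assms unfolding ereal_log_def by (cases x) (auto simp: zero_ereal_def mult_le_0_iff ln_mult)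

lemma ereal_log_powr:
  assumes "t > 0" "0 \<le> y"
  shows "ereal_log (ereal (y powr t)) = ereal t * ereal_log (ereal y)"
  using assms unfolding ereal_log_def by (auto simp: zero_ereal_def ln_powr)

lemma separated_sum_antimono:
  assumes "\<epsilon> \<le> \<delta>"
  shows "separated_sum T \<psi> \<delta> n \<le> separated_sum T \<psi> \<epsilon> n"
  unfolding separated_sum_def separated_def using assms
  by (intro SUP_subset_mono) fastforce+

lemma pressure_at_scale_antimono:
  assumes "\<epsilon> \<le> \<delta>"
  shows "pressure_at_scale T \<psi> \<delta> \<le> pressure_at_scale T \<psi> \<epsilon>"
  unfolding pressure_at_scale_def using assms
  by (intro Limsup_mono always_eventually allI ereal_mult_left_mono ereal_log_mono separated_sum_antimono) auto

text \<open>A smaller scale admits more separated sets, so the one-sided limit in the definition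
  exists and is a supremum. Thus one convenient scale suffices for a lower bound, and a bound
  uniform in the scale for an upper bound.\<close>

lemma pressure_eq_SUP: "pressure T \<psi> = (SUP \<epsilon>\<in>{0<..}. pressure_at_scale T \<psi> \<epsilon>)" (is "_ = ?S")
proof -
  have "(pressure_at_scale T \<psi> \<longlongrightarrow> ?S) (at_right 0)"
  proof (rule order_tendstoI)
    fix l assume "l < ?S"
    then obtain \<epsilon> where \<epsilon>: "\<epsilon> > 0" "l < pressure_at_scale T \<psi> \<epsilon>" by (auto simp: less_SUP_iff)
    have "eventually (\<lambda>x. x \<in> {0<..<\<epsilon>}) (at_right (0::real))"
      using \<epsilon>(1) by (rule eventually_at_right_real)
    then show "eventually (\<lambda>x. l < pressure_at_scale T \<psi> x) (at_right 0)"
      by eventually_elim (auto intro!: less_le_trans[OF \<epsilon>(2)] pressure_at_scale_antimono)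
  next
    fix u assume u: "?S < u"
    have "eventually (\<lambda>x. x \<in> {0<..<1}) (at_right (0::real))"
      by (rule eventually_at_right_real) simp
    then show "eventually (\<lambda>x. pressure_at_scale T \<psi> x < u) (at_right 0)"
      by eventually_elim (auto intro: le_less_trans[OF SUP_upper u])
  qed
  then show ?thesis unfolding pressure_def by (intro tendsto_Lim) auto
qed

section \<open>Shannon entropy of itineraries\<close>

lemma open_inner_closed:
  fixes M :: "'a::metric_space measure"
  assumes "finite_measure M" "sets M = sets borel" "open A" "e > 0"
  shows "\<exists>C\<subseteq>A. closed C \<and> measure M (A - C) < e"
\<comment> \<open>The distance to an empty complement is 0 by convention, so the whole space is
  treated apart.\<close>
proof (cases "A = UNIV")
  case False
  interpret finite_measure M by fact
  define C where "C n = {x. 1 / real (Suc n) \<le> infdist x (- A)}" for n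
  have cl: "closed (C n)" for n
    unfolding C_def by (intro closed_Collect_le continuous_intros)
  have A: "x \<in> A \<longleftrightarrow> infdist x (- A) > 0" for x
    using False \<open>open A\<close> in_closed_iff_infdist_zero[of "- A" x] infdist_nonneg[of x "- A"]
    by (auto simp: less_le)
  have CA: "C n \<subseteq> A" for n
  proof
    fix x assume "x \<in> C n"
    then have "0 < 1 / real (Suc n)" "1 / real (Suc n) \<le> infdist x (- A)" by (auto simp: C_def)
    then show "x \<in> A" unfolding A by linarith
  qed
  have "\<exists>n. x \<in> C n" if "x \<in> A" for x
    using reals_Archimedean[of "infdist x (- A)"] that unfolding A C_def
    by (auto simp: inverse_eq_divide intro: less_imp_le)
  then have empty: "(\<Inter>n. A - C n) = {}" by auto
  have "C n \<subseteq> C (Suc n)" for n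
    unfolding C_def by (auto intro: order_trans[rotated] simp: frac_le)
  then have "decseq (\<lambda>n. A - C n)" by (intro decseq_SucI) auto
  moreover have "range (\<lambda>n. A - C n) \<subseteq> sets M" using cl \<open>open A\<close> assms(2) by auto
  ultimately have "(\<lambda>n. measure M (A - C n)) \<longlonglongrightarrow> measure M (\<Inter>n. A - C n)"
    by (intro finite_Lim_measure_decseq) auto
  then have "eventually (\<lambda>n. measure M (A - C n) < e) sequentially"
    unfolding empty using \<open>e > 0\<close> by (intro order_tendstoD(2)) auto
  then obtain n where "measure M (A - C n) < e" by (auto simp: eventually_sequentially)
  then show ?thesis using cl CA by blast
qed (use assms in \<open>auto intro!: exI[of _ UNIV]\<close>)

text \<open>The sets that can be sandwiched in this way include the open sets and are stable under
  complement, which exchanges the two approximants, and under countable union.\<close>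

lemma closed_open_approximation:
  fixes M :: "'a::metric_space measure"
  assumes "finite_measure M" "sets M = sets borel" "A \<in> sets M" "e > 0"
  shows "\<exists>C U. closed C \<and> open U \<and> C \<subseteq> A \<and> A \<subseteq> U \<and> measure M (U - C) < e"
proof -
  interpret finite_measure M by fact
  note [simp] = assms(2)
  have "A \<in> sigma_sets UNIV {S. open S}" using assms(2,3) by (simp add: borel_def)
  then show ?thesis using assms(4)
  proof (induction arbitrary: e rule: sigma_sets.induct)
    case (Basic A)
    then show ?case
      using open_inner_closed[OF assms(1,2), of A e] by blast
  next
    case Empty
    then show ?case by (intro exI[of _ "{}"]) auto
  next
    case (Compl A)
    obtain C U where "closed C" "open U" "C \<subseteq> A" "A \<subseteq> U" "measure M (U - C) < e"
      using Compl.IH[OF Compl.prems] by blast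
    moreover have "- C - (- U) = U - C" by auto
    ultimately show ?case
      by (intro exI[of _ "- U"] exI[of _ "- C"]) (auto simp: closed_Compl open_Compl)
  next
    case (Union A)
    \<comment> \<open>The errors sum to e/2, strictly less than e; the remaining room pays for the
      passage to finitely many closed sets.\<close>
    have "\<exists>C U. closed C \<and> open U \<and> C \<subseteq> A i \<and> A i \<subseteq> U \<and> measure M (U - C) < e / 2 * (1 / 2) ^ Suc i" for i
      using Union.IH[of "e / 2 * (1 / 2) ^ Suc i" i] Union.prems by simp
    then obtain C U where CU: "closed (C i)" "open (U i)" "C i \<subseteq> A i" "A i \<subseteq> U i"
        "measure M (U i - C i) < e / 2 * (1 / 2) ^ Suc i" for i
      by metis
    have [measurable]: "C i \<in> sets M" "U i \<in> sets M" for i using CU by auto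
    have [simp]: "U i - C i \<in> sets borel" for i using CU by auto
    have sums: "(\<lambda>i. e / 2 * (1 / 2) ^ Suc i) sums (e / 2 * 1)"
      by (intro sums_mult power_half_series)
    have sm: "summable (\<lambda>i. measure M (U i - C i))"
      using CU(5) by (intro summable_comparison_test'[OF sums_summable[OF sums], of 0]) (auto intro: less_imp_le)
    have "measure M ((\<Union>i. U i) - (\<Union>i. C i)) \<le> measure M (\<Union>i. U i - C i)"
    proof (rule finite_measure_mono)
      show "(\<Union>i. U i - C i) \<in> sets M" by measurable
    qed auto
    also have "\<dots> \<le> (\<Sum>i. measure M (U i - C i))"
      by (intro finite_measure_subadditive_countably sm) auto
    also have "\<dots> \<le> (\<Sum>i. e / 2 * (1 / 2) ^ Suc i)"
      using CU(5) by (intro suminf_le sm sums_summable[OF sums]) (auto intro: less_imp_le)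
    also have "\<dots> < e" using sums_unique[OF sums] Union.prems by simp
    finally have lt: "measure M ((\<Union>i. U i) - (\<Union>i. C i)) < e" .
    \<comment> \<open>The union of all \<open>C i\<close> need not be closed. The finite unions are,
      and continuity from above shows that one of them is large enough.\<close>
    define K where "K k = (\<Union>i<k. C i)" for k
    have clK: "closed (K k)" for k unfolding K_def using CU by auto
    have opU: "open (\<Union>i. U i)" using CU by auto
    have [simp]: "(\<Union>i. U i) - K k \<in> sets borel" for k using clK opU by auto
    have "(\<lambda>k. measure M ((\<Union>i. U i) - K k)) \<longlonglongrightarrow> measure M (\<Inter>k. (\<Union>i. U i) - K k)"
    proof (rule finite_Lim_measure_decseq)
      show "decseq (\<lambda>k. (\<Union>i. U i) - K k)"
        unfolding K_def by (intro decseq_SucI Diff_mono UN_mono) auto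
    qed auto
    moreover have "(\<Inter>k. (\<Union>i. U i) - K k) = (\<Union>i. U i) - (\<Union>i. C i)" unfolding K_def by auto
    ultimately have "eventually (\<lambda>k. measure M ((\<Union>i. U i) - K k) < e) sequentially"
      using lt by (intro order_tendstoD(2)) auto
    then obtain k where "measure M ((\<Union>i. U i) - K k) < e" by (auto simp: eventually_sequentially)
    moreover have "K k \<subseteq> (\<Union>i. A i)" unfolding K_def by (intro UN_mono CU(3)) simp
    moreover have "(\<Union>i. A i) \<subseteq> (\<Union>i. U i)" by (intro UN_mono CU(4)) simp
    ultimately show ?case
      by (intro exI[of _ "K k"] exI[of _ "\<Union>i. U i"] conjI clK opU)
  qed
qed

text \<open>Partitions are encoded by finite-valued labels: the fibres are the cells, pairing is the
  join, and refinement is functional dependence. Null fibres contribute 0 by the convention 0 * ln 0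
  = 0.\<close>

definition shannon :: "'a measure \<Rightarrow> ('a \<Rightarrow> 'b) \<Rightarrow> real" where
  "shannon M f = - (\<Sum>y\<in>range f. measure M (f -` {y}) * ln (measure M (f -` {y})))"

text \<open>The restriction fixes the value at times outside {..<n}, so that equality means
  agreement before time n and itineraries are elements of a finite \<open>PiE\<close>
  product.\<close>

definition itinerary :: "('a \<Rightarrow> 'a) \<Rightarrow> ('a \<Rightarrow> 'b) \<Rightarrow> nat \<Rightarrow> 'a \<Rightarrow> nat \<Rightarrow> 'b" where
  "itinerary T f n x = (\<lambda>k\<in>{..<n}. f ((T ^^ k) x))"

text \<open>Gibbs' inequality requires positive probabilities, and a representative point can be
  found by averaging only in a cell of positive measure.\<close>

definition support :: "'a measure \<Rightarrow> ('a \<Rightarrow> 'b) \<Rightarrow> 'b set" where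
  "support M f = {y \<in> range f. measure M (f -` {y}) > 0}"

lemma itinerary_eq_iff: "itinerary T f n x = itinerary T f n y \<longleftrightarrow> (\<forall>k<n. f ((T ^^ k) x) = f ((T ^^ k) y))"
  by (auto simp: itinerary_def fun_eq_iff restrict_def)

lemma simple_function_restrict:
  assumes "finite I" "space M = UNIV" "\<And>k. k \<in> I \<Longrightarrow> simple_function M (g k)"
  shows "simple_function M (\<lambda>x. \<lambda>k\<in>I. g k x)"
  unfolding simple_function_def
proof safe
  have "range (\<lambda>x. \<lambda>k\<in>I. g k x) \<subseteq> PiE I (\<lambda>k. range (g k))" by auto
  moreover have "finite (PiE I (\<lambda>k. range (g k)))"
    using assms(1) simple_functionD(1)[OF assms(3)] by (intro finite_PiE) (simp_all add: assms(2))
  ultimately show "finite ((\<lambda>x. \<lambda>k\<in>I. g k x) ` space M)"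
    unfolding assms(2) by (rule finite_subset)
next
  fix x0
  let ?y = "\<lambda>k\<in>I. g k x0"
  have eq_iff: "(\<lambda>k\<in>I. g k x) = ?y \<longleftrightarrow> (\<forall>k\<in>I. g k x = g k x0)" for x
  proof
    assume eq: "(\<lambda>k\<in>I. g k x) = ?y"
    show "\<forall>k\<in>I. g k x = g k x0"
    proof
      fix k assume "k \<in> I"
      then show "g k x = g k x0" using fun_cong[OF eq, of k] by simp
    qed
  qed (auto intro: restrict_ext)
  have "(\<lambda>x. \<lambda>k\<in>I. g k x) -` {?y} \<inter> space M = {x \<in> space M. \<forall>k\<in>I. x \<in> g k -` {g k x0}}"
    by (simp only: set_eq_iff Int_iff vimage_singleton_eq mem_Collect_eq eq_iff) blast
  also have "\<dots> \<in> sets M"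
  proof (intro sets.sets_Collect_finite_All assms(1))
    fix k assume "k \<in> I"
    then have "g k -` {g k x0} \<inter> space M \<in> sets M" using simple_functionD(2)[OF assms(3)] by blast
    then show "{x \<in> space M. x \<in> g k -` {g k x0}} \<in> sets M" by (simp add: assms(2) Int_def)
  qed
  finally show "(\<lambda>x. \<lambda>k\<in>I. g k x) -` {?y} \<inter> space M \<in> sets M" .
qed

context prob_space begin

context
  assumes space_UNIV [simp]: "space M = UNIV"
begin

lemma fibre_sets: "simple_function M f \<Longrightarrow> f -` A \<in> sets M"
  using simple_functionD(2)[of M f A] by simp

lemma finite_range_simple: "simple_function M f \<Longrightarrow> finite (range f)"
  using simple_functionD(1)[of M f] by simp

lemma finite_support: "simple_function M f \<Longrightarrow> finite (support M f)"
  unfolding support_def using finite_range_simple[of f] by auto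

lemma sum_support:
  assumes "simple_function M f"
  shows "(\<Sum>y\<in>support M f. prob (f -` {y}) * G y) = (\<Sum>y\<in>range f. prob (f -` {y}) * G y)"
  unfolding support_def using finite_range_simple[OF assms] measure_nonneg[of M]
  by (intro sum.mono_neutral_left) (auto simp: less_le)

text \<open>Turns sums over labels into integrals over the common space, where entropies of labels
  with different ranges can be compared pointwise through their information functions.\<close>

lemma has_integral_label:
  fixes G :: "'b \<Rightarrow> real"
  assumes "simple_function M f"
  shows "integrable M (\<lambda>x. G (f x))"
    and "(\<integral>x. G (f x) \<partial>M) = (\<Sum>y\<in>support M f. prob (f -` {y}) * G y)"
proof -
  have eq: "G (f x) = (\<Sum>y\<in>range f. G y * indicator (f -` {y}) x)" for x
    using finite_range_simple[OF assms] by (simp add: indicator_def if_distrib cong: if_cong)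
  have int: "integrable M (\<lambda>x. G y * indicator (f -` {y}) x)" for y
    using fibre_sets[OF assms] by (intro integrable_mult_right integrable_real_indicator) (auto simp: emeasure_eq_measure)
  show "integrable M (\<lambda>x. G (f x))" unfolding eq by (intro Bochner_Integration.integrable_sum int)
  have "(\<integral>x. G (f x) \<partial>M) = (\<Sum>y\<in>range f. \<integral>x. G y * indicator (f -` {y}) x \<partial>M)"
    unfolding eq by (intro Bochner_Integration.integral_sum int)
  also have "\<dots> = (\<Sum>y\<in>range f. prob (f -` {y}) * G y)"
    using fibre_sets[OF assms] by (intro sum.cong) auto
  finally show "(\<integral>x. G (f x) \<partial>M) = (\<Sum>y\<in>support M f. prob (f -` {y}) * G y)"
    by (simp add: sum_support[OF assms])
qed

lemma sum_support_prob: "simple_function M f \<Longrightarrow> (\<Sum>y\<in>support M f. prob (f -` {y})) = 1"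
  using has_integral_label(2)[of f "\<lambda>_. 1"] prob_space by simp

lemma shannon_support:
  "simple_function M f \<Longrightarrow> shannon M f = - (\<Sum>y\<in>support M f. prob (f -` {y}) * ln (prob (f -` {y})))"
  unfolding shannon_def by (simp add: sum_support)

lemma shannon_integral:
  "simple_function M f \<Longrightarrow> shannon M f = - (\<integral>x. ln (prob (f -` {f x})) \<partial>M)"
  by (simp add: shannon_support has_integral_label(2)[of f "\<lambda>y. ln (prob (f -` {y}))"])

text \<open>The finite form of the variational principle: entropy plus mean energy is at most the
  logarithm of the partition function of the unnormalised weights \<open>q\<close>.\<close>

lemma shannon_gibbs:
  assumes f: "simple_function M f" and q: "\<And>y. y \<in> support M f \<Longrightarrow> q y > 0"
  shows "shannon M f + (\<integral>x. ln (q (f x)) \<partial>M) \<le> ln (\<Sum>y\<in>support M f. q y)"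
proof -
  have "shannon M f + (\<integral>x. ln (q (f x)) \<partial>M) =
      (\<Sum>y\<in>support M f. prob (f -` {y}) * (ln (q y) - ln (prob (f -` {y}))))"
    by (simp add: shannon_support[OF f] has_integral_label(2)[OF f, of "\<lambda>y. ln (q y)"]
        right_diff_distrib sum_subtractf)
  also have "\<dots> \<le> ln (\<Sum>y\<in>support M f. q y)"
    by (intro gibbs_inequality finite_support sum_support_prob f q) (auto simp: support_def)
  finally show ?thesis .
qed

lemma ln_le_zero: "ln (prob A) \<le> 0"
  by (cases "prob A = 0") (simp_all add: zero_less_measure_iff)

lemma shannon_nonneg: "shannon M f \<ge> 0"
proof -
  have "(\<Sum>y\<in>range f. prob (f -` {y}) * ln (prob (f -` {y}))) \<le> 0"
    by (intro sum_nonpos mult_nonneg_nonpos) (simp_all add: ln_le_zero)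
  then show ?thesis by (simp add: shannon_def)
qed

text \<open>A cell of \<open>g\<close> lies inside a cell of \<open>f\<close>, so it has smaller
  measure and larger information. The auxiliary \<open>h\<close> is the factor map with f = h o g;
  the choice of preimage in it does not matter because \<open>f\<close> is constant on the fibres of
  \<open>g\<close>.\<close>

lemma shannon_refine:
  assumes f: "simple_function M f" and g: "simple_function M g"
    and refine: "\<And>x y. g x = g y \<Longrightarrow> f x = f y"
  shows "shannon M f \<le> shannon M g"
proof -
  define h where "h z = f (SOME x. g x = z)" for z
  have h: "h (g x) = f x" for x unfolding h_def by (rule refine, rule someI[of _ x]) simp
  have "(\<Sum>z\<in>support M g. prob (g -` {z}) * ln (prob (g -` {z})))
      \<le> (\<Sum>z\<in>support M g. prob (g -` {z}) * ln (prob (f -` {h z})))"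
  proof (rule sum_mono)
    fix z assume z: "z \<in> support M g"
    then obtain x where x: "z = g x" by (auto simp: support_def)
    have "g -` {z} \<subseteq> f -` {h z}" unfolding x h by (auto intro: refine)
    then have "prob (g -` {z}) \<le> prob (f -` {h z})"
      using fibre_sets[OF f] by (intro finite_measure_mono) auto
    then show "prob (g -` {z}) * ln (prob (g -` {z})) \<le> prob (g -` {z}) * ln (prob (f -` {h z}))"
      using z by (intro mult_left_mono) (auto simp: support_def)
  qed
  also have "\<dots> = (\<integral>x. ln (prob (f -` {f x})) \<partial>M)"
    by (simp add: has_integral_label(2)[OF g, of "\<lambda>z. ln (prob (f -` {h z}))", symmetric] h)
  finally show ?thesis by (simp add: shannon_support[OF g] shannon_integral[OF f])
qed

text \<open>Gibbs' inequality against the product of the two marginals, whose mass on the joint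
  support is at most 1.\<close>

lemma shannon_Pair:
  assumes f: "simple_function M f" and g: "simple_function M g"
  shows "shannon M (\<lambda>x. (f x, g x)) \<le> shannon M f + shannon M g"
proof -
  let ?d = "\<lambda>x. (f x, g x)"
  define q where "q = (\<lambda>(y, z). prob (f -` {y}) * prob (g -` {z}))"
  have d: "simple_function M ?d" using f g by (rule simple_function_Pair)
  have pos: "prob (f -` {fst y}) > 0 \<and> prob (g -` {snd y}) > 0" if "y \<in> support M ?d" for y
  proof -
    have "prob (?d -` {y}) \<le> prob (f -` {fst y})" "prob (?d -` {y}) \<le> prob (g -` {snd y})"
      using fibre_sets[OF f] fibre_sets[OF g] by (auto intro!: finite_measure_mono)
    then show ?thesis using that by (auto simp: support_def)
  qed
  have "(\<Sum>y\<in>support M ?d. q y) \<le> (\<Sum>y\<in>range f \<times> range g. q y)"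
    using finite_range_simple[OF f] finite_range_simple[OF g] by (intro sum_mono2) (auto simp: support_def q_def)
  also have "\<dots> = (\<Sum>y\<in>range f. prob (f -` {y})) * (\<Sum>z\<in>range g. prob (g -` {z}))"
    by (simp add: q_def sum_product sum.cartesian_product)
  also have "\<dots> = 1"
    using sum_support[OF f, of "\<lambda>_. 1"] sum_support[OF g, of "\<lambda>_. 1"] sum_support_prob[OF f] sum_support_prob[OF g] by simp
  finally have le1: "(\<Sum>y\<in>support M ?d. q y) \<le> 1" .
  have "support M ?d \<noteq> {}" using sum_support_prob[OF d] by auto
  then have "(\<Sum>y\<in>support M ?d. q y) > 0"
    using pos by (intro sum_pos finite_support d) (auto simp: q_def)
  then have "ln (\<Sum>y\<in>support M ?d. q y) \<le> 0" using le1 by simp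
  moreover have "shannon M ?d + (\<integral>x. ln (q (?d x)) \<partial>M) \<le> ln (\<Sum>y\<in>support M ?d. q y)"
    using pos by (intro shannon_gibbs d) (auto simp: q_def)
  moreover have "(\<integral>x. ln (q (?d x)) \<partial>M) = - shannon M f - shannon M g"
  proof -
    have "(\<integral>x. ln (q (?d x)) \<partial>M) = (\<Sum>y\<in>support M ?d. prob (?d -` {y}) * ln (q y))"
      by (rule has_integral_label(2)[OF d, of "\<lambda>y. ln (q y)"])
    also have "\<dots> = (\<Sum>y\<in>support M ?d. prob (?d -` {y}) * (ln (prob (f -` {fst y})) + ln (prob (g -` {snd y}))))"
    proof (rule sum.cong[OF HOL.refl])
      fix y assume "y \<in> support M ?d"
      then show "prob (?d -` {y}) * ln (q y) = prob (?d -` {y}) * (ln (prob (f -` {fst y})) + ln (prob (g -` {snd y})))"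
        using pos[of y] by (cases y) (simp add: q_def ln_mult)
    qed
    also have "\<dots> = (\<integral>x. ln (prob (f -` {f x})) + ln (prob (g -` {g x})) \<partial>M)"
      using has_integral_label(2)[OF d, of "\<lambda>y. ln (prob (f -` {fst y})) + ln (prob (g -` {snd y}))"] by simp
    also have "\<dots> = - shannon M f - shannon M g"
      using has_integral_label(1)[OF f, of "\<lambda>y. ln (prob (f -` {y}))"]
        has_integral_label(1)[OF g, of "\<lambda>y. ln (prob (g -` {y}))"]
      by (subst Bochner_Integration.integral_add) (simp_all add: shannon_integral f g)
    finally show ?thesis .
  qed
  ultimately show ?thesis by simp
qed

end

end

section \<open>Measure-preserving maps and the entropy rate of a label\<close>

locale invariant_prob = prob_space M for M :: "'a measure" +
  fixes T :: "'a \<Rightarrow> 'a"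
  assumes space_UNIV [simp]: "space M = UNIV"
    and measurable_T [measurable]: "T \<in> M \<rightarrow>\<^sub>M M"
    and distr_T: "distr M M T = M"
begin

lemma measurable_funpow [measurable]: "T ^^ k \<in> M \<rightarrow>\<^sub>M M"
proof (induction k)
  case (Suc k)
  show ?case unfolding funpow.simps by (rule measurable_comp[OF Suc measurable_T])
qed (simp add: id_def)

lemma distr_funpow: "distr M M (T ^^ k) = M"
proof (induction k)
  case (Suc k)
  have "distr M M (T ^^ Suc k) = distr (distr M M (T ^^ k)) M T"
    by (subst distr_distr) simp_all
  also have "\<dots> = M" by (simp only: Suc distr_T)
  finally show ?case .
qed (simp add: id_def distr_id)

lemma measure_funpow: "A \<in> sets M \<Longrightarrow> prob ((T ^^ k) -` A) = prob A"
  using measure_distr[of "T ^^ k" M M A] by (simp add: distr_funpow)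

lemma integral_funpow:
  fixes f :: "'a \<Rightarrow> real"
  shows "f \<in> borel_measurable M \<Longrightarrow> (\<integral>x. f ((T ^^ k) x) \<partial>M) = (\<integral>x. f x \<partial>M)"
  using integral_distr[of "T ^^ k" M M f] by (simp add: distr_funpow)

lemma integrable_funpow:
  fixes f :: "'a \<Rightarrow> real"
  shows "integrable M f \<Longrightarrow> integrable M (\<lambda>x. f ((T ^^ k) x))"
  using integrable_distr_eq[of "T ^^ k" M M f] by (simp add: distr_funpow)

lemma simple_function_funpow:
  assumes "simple_function M f"
  shows "simple_function M (\<lambda>x. f ((T ^^ k) x))"
  unfolding simple_function_def
proof safe
  show "finite ((\<lambda>x. f ((T ^^ k) x)) ` space M)"
    using finite_range_simple[OF space_UNIV assms] by (rule finite_subset[rotated]) auto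
  fix x
  have "(T ^^ k) -` (f -` {f ((T ^^ k) x)}) \<inter> space M \<in> sets M"
    by (rule measurable_sets[OF measurable_funpow fibre_sets[OF space_UNIV assms]])
  then show "(\<lambda>x. f ((T ^^ k) x)) -` {f ((T ^^ k) x)} \<inter> space M \<in> sets M"
    by (simp add: vimage_def)
qed

lemma simple_function_itinerary:
  "simple_function M f \<Longrightarrow> simple_function M (itinerary T f n)"
  unfolding itinerary_def[abs_def]
  by (intro simple_function_restrict simple_function_funpow) auto

lemma shannon_funpow:
  assumes f: "simple_function M f"
  shows "shannon M (\<lambda>x. f ((T ^^ k) x)) = shannon M f"
proof -
  have p: "prob ((\<lambda>x. f ((T ^^ k) x)) -` {y}) = prob (f -` {y})" for y
    using measure_funpow[OF fibre_sets[OF space_UNIV f], of k "{y}"] by (simp add: vimage_def)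
  have "shannon M (\<lambda>x. f ((T ^^ k) x)) = - (\<integral>x. ln (prob (f -` {f ((T ^^ k) x)})) \<partial>M)"
    by (simp add: shannon_integral[OF space_UNIV simple_function_funpow[OF f]] p)
  also have "\<dots> = - (\<integral>x. ln (prob (f -` {f x})) \<partial>M)"
    using has_integral_label(1)[OF space_UNIV f, of "\<lambda>y. ln (prob (f -` {y}))"]
    by (subst integral_funpow) auto
  finally show ?thesis by (simp add: shannon_integral[OF space_UNIV f])
qed

text \<open>An itinerary of length m + n is determined by the one of length m from x and the one of
  length n from \<open>(T ^^ m) x\<close>; by invariance the latter has the same entropy as the one
  from x.\<close>

lemma shannon_itinerary_subadditive:
  assumes f: "simple_function M f"
  shows "shannon M (itinerary T f (m + n)) \<le> shannon M (itinerary T f m) + shannon M (itinerary T f n)"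
proof -
  let ?d = "\<lambda>x. (itinerary T f m x, itinerary T f n ((T ^^ m) x))"
  note sf = simple_function_itinerary[OF f]
  have d: "simple_function M ?d"
    by (intro simple_function_Pair sf simple_function_funpow)
  have "shannon M (itinerary T f (m + n)) \<le> shannon M ?d"
  proof (rule shannon_refine[OF space_UNIV sf d])
    fix x y assume eq: "?d x = ?d y"
    have "f ((T ^^ k) x) = f ((T ^^ k) y)" if k: "k < m + n" for k
    proof (cases "k < m")
      case False
      then obtain j where j: "k = j + m" "j < n" using k by (metis add.commute le_iff_add nat_add_left_cancel_less not_less)
      then show ?thesis using eq by (auto simp: itinerary_eq_iff funpow_add)
    qed (use eq in \<open>auto simp: itinerary_eq_iff\<close>)
    then show "itinerary T f (m + n) x = itinerary T f (m + n) y" by (simp add: itinerary_eq_iff)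
  qed
  also have "\<dots> \<le> shannon M (itinerary T f m) + shannon M (\<lambda>x. itinerary T f n ((T ^^ m) x))"
    by (intro shannon_Pair space_UNIV sf simple_function_funpow)
  also have "shannon M (\<lambda>x. itinerary T f n ((T ^^ m) x)) = shannon M (itinerary T f n)"
    by (rule shannon_funpow[OF sf])
  finally show ?thesis .
qed

text \<open>The label \<open>g x\<close> is the cell containing x. The nonempty cells of the join
  are exactly the fibres over the range of the itinerary, so the sum over cells becomes a sum over
  labels.\<close>

lemma partition_entropy_iterated_join:
  assumes P: "finite P" "P \<subseteq> sets M" "partition_on UNIV P"
  obtains g :: "'a \<Rightarrow> 'a set" where "simple_function M g"
    "\<And>n. partition_entropy M (iterated_join T P n) = shannon M (itinerary T g n)"
proof -
  have "\<forall>x. \<exists>A\<in>P. x \<in> A" using P(3) by (auto simp: partition_on_def)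
  then obtain g where g: "g x \<in> P" "x \<in> g x" for x by metis
  have g_eq: "g x = A \<longleftrightarrow> x \<in> A" if "A \<in> P" for x A
    using g[of x] that P(3) by (auto simp: partition_on_def disjoint_def)
  have sf: "simple_function M g"
    unfolding simple_function_def
  proof safe
    show "finite (g ` space M)" using finite_subset[of "range g" P] P(1) g by auto
    fix x
    have "g -` {g x} = g x" using g_eq[OF g(1)] by auto
    then show "g -` {g x} \<inter> space M \<in> sets M" using P(2) g(1)[of x] by auto
  qed
  have "partition_entropy M (iterated_join T P n) = shannon M (itinerary T g n)" for n
  proof -
    let ?i = "itinerary T g n"
    have fib: "?i -` {?i x} = (\<Inter>k<n. (T ^^ k) -` g ((T ^^ k) x))" for x
      using g_eq[OF g(1)] by (auto simp: itinerary_eq_iff)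
    have "iterated_join T P n = (\<lambda>y. ?i -` {y}) ` range ?i"
    proof safe
      fix A assume "A \<in> iterated_join T P n"
      then obtain a x where a: "A = (\<Inter>k<n. (T ^^ k) -` a k)" "\<forall>k<n. a k \<in> P" "x \<in> A"
        by (auto simp: iterated_join_def)
      have "g ((T ^^ k) x) = a k" if "k < n" for k
        using a that by (subst g_eq) auto
      then have "A = ?i -` {?i x}" unfolding fib a(1) by auto
      then show "A \<in> (\<lambda>y. ?i -` {y}) ` range ?i" by auto
    next
      fix x
      have "\<exists>a. ?i -` {?i x} = (\<Inter>k<n. (T ^^ k) -` a k) \<and> (\<forall>k<n. a k \<in> P)"
        using g by (intro exI[of _ "\<lambda>k. g ((T ^^ k) x)"]) (auto simp: fib)
      moreover have "x \<in> ?i -` {?i x}" by simp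
      ultimately show "?i -` {?i x} \<in> iterated_join T P n"
        unfolding iterated_join_def by blast
    qed
    moreover have "inj_on (\<lambda>y. ?i -` {y}) (range ?i)" by (rule inj_onI) auto
    ultimately show ?thesis
      by (simp add: partition_entropy_def shannon_def sum.reindex)
  qed
  then show thesis by (rule that[OF sf])
qed

text \<open>The entropy rate is defined by \<open>lim\<close>, which carries information only once
  convergence is known.\<close>

lemma partition_entropy_rate_limit:
  assumes f: "simple_function M f"
  shows "convergent (\<lambda>n. shannon M (itinerary T f n) / real n)"
  by (rule fekete_nonneg[OF shannon_nonneg[OF space_UNIV] shannon_itinerary_subadditive[OF f]])

end

section \<open>The entropy bound for blocks\<close>

lemma bowen_dist_ge: "k < n \<Longrightarrow> dist ((T ^^ k) x) ((T ^^ k) y) \<le> bowen_dist T n x y"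
  unfolding bowen_dist_def by (intro Max_ge) auto

lemma bowen_dist_commute: "bowen_dist T n x y = bowen_dist T n y x"
  by (simp add: bowen_dist_def dist_commute)

lemma bowen_dist_self: "n \<ge> 1 \<Longrightarrow> bowen_dist T n x x = 0"
  by (auto simp: bowen_dist_def image_constant_conv lessThan_empty_iff)

lemma compact_closed_separation:
  fixes A B :: "'a::metric_space set"
  assumes "compact A" "closed B" "A \<inter> B = {}"
  shows "\<exists>d>0. \<forall>a\<in>A. \<forall>b\<in>B. d \<le> dist a b"
proof (cases "A = {} \<or> B = {}")
  case False
  have "continuous_on A (\<lambda>x. infdist x B)" by (intro continuous_intros)
  then obtain x where x: "x \<in> A" "\<forall>a\<in>A. infdist x B \<le> infdist a B"
    using continuous_attains_inf[OF assms(1), of "\<lambda>x. infdist x B"] False by blast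
  have "infdist x B > 0"
    using x(1) assms(2,3) False in_closed_iff_infdist_zero[of B x] infdist_nonneg[of x B]
    by (auto simp: less_le)
  then show ?thesis
    using x(2) by (intro exI[of _ "infdist x B"]) (auto intro: order_trans infdist_le)
qed (auto intro: exI[of _ 1])

text \<open>The factor 2 is for the triangle inequality: a ball of radius \<epsilon> can then meet
  at most one of the sets.\<close>

lemma closed_family_separation:
  fixes C :: "'i \<Rightarrow> 'a::metric_space set"
  assumes "compact (UNIV :: 'a set)" "finite I" "\<And>i. i \<in> I \<Longrightarrow> closed (C i)"
    and disj: "\<And>i j. i \<in> I \<Longrightarrow> j \<in> I \<Longrightarrow> i \<noteq> j \<Longrightarrow> C i \<inter> C j = {}"
  shows "\<exists>\<epsilon>>0. \<forall>i\<in>I. \<forall>j\<in>I. \<forall>a\<in>C i. \<forall>b\<in>C j. i \<noteq> j \<longrightarrow> 2 * \<epsilon> < dist a b"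
proof -
  have "\<exists>d>0. fst p \<noteq> snd p \<longrightarrow> (\<forall>a\<in>C (fst p). \<forall>b\<in>C (snd p). d \<le> dist a b)" if p: "p \<in> I \<times> I" for p
  proof (cases "fst p = snd p")
    case False
    have "compact (C (fst p))"
      using compact_Int_closed[OF assms(1), of "C (fst p)"] assms(3) p by auto
    moreover have "closed (C (snd p))" using assms(3) p by auto
    moreover have "C (fst p) \<inter> C (snd p) = {}" using disj[OF _ _ False] p by auto
    ultimately show ?thesis using compact_closed_separation by metis
  qed (auto intro: exI[of _ 1])
  then obtain d where d: "\<And>p. p \<in> I \<times> I \<Longrightarrow> d p > (0::real)"
    "\<And>p a b. p \<in> I \<times> I \<Longrightarrow> fst p \<noteq> snd p \<Longrightarrow> a \<in> C (fst p) \<Longrightarrow> b \<in> C (snd p) \<Longrightarrow> d p \<le> dist a b"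
    by metis
  \<comment> \<open>The element 1 keeps the minimum meaningful when \<open>I\<close> is empty.
    Below, \<delta> / 3 makes the bound strict, since 2 \<delta> / 3 < \<delta>.\<close>
  define \<delta> where "\<delta> = Min (insert 1 (d ` (I \<times> I)))"
  have fin: "finite (insert 1 (d ` (I \<times> I)))" using assms(2) by auto
  have pos: "\<delta> > 0" unfolding \<delta>_def using fin d(1) by (subst Min_gr_iff) auto
  have "2 * (\<delta> / 3) < dist a b" if "i \<in> I" "j \<in> I" "a \<in> C i" "b \<in> C j" "i \<noteq> j" for i j a b
  proof -
    have "\<delta> \<le> d (i, j)" unfolding \<delta>_def using that fin by (intro Min_le) auto
    then show ?thesis using d(2)[of "(i, j)" a b] that pos by auto
  qed
  then show ?thesis using pos by (intro exI[of _ "\<delta> / 3"]) auto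
qed

context invariant_prob begin

text \<open>Lets labels be recorded along \<open>T ^^ N\<close>, one per block, with the measure
  unchanged.\<close>

lemma invariant_prob_funpow: "invariant_prob M (T ^^ N)"
  by unfold_locales (auto simp only: space_UNIV measurable_funpow distr_funpow)

text \<open>If ln h stayed below its conditional mean minus 1 on \<open>D\<close>, integration would
  give I \<le> I - prob D. Positivity of h at the chosen point has to be part of the claim: as
  \<open>ln 0 = 0\<close>, a zero of h could pass the test on ln h.\<close>

lemma point_above_average:
  assumes D: "D \<in> sets M" "prob D > 0"
    and h: "AE x in M. h x > 0" "integrable M (\<lambda>x. ln (h x))"
  shows "\<exists>x\<in>D. h x > 0 \<and> (\<integral>x. indicator D x * ln (h x) \<partial>M) \<le> prob D * (ln (h x) + 1)"
proof (rule ccontr)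
  define I where "I = (\<integral>x. indicator D x * ln (h x) \<partial>M)"
  assume "\<not> ?thesis"
  then have lt: "prob D * (ln (h x) + 1) < I" if "x \<in> D" "h x > 0" for x
    using that by (force simp: I_def not_le)
  have int: "integrable M (\<lambda>x. indicator D x * ln (h x))"
    using integrable_mult_indicator[OF D(1) h(2)] by simp
  have int': "integrable M (\<lambda>x. indicator D x * (I / prob D - 1))"
    using D(1) by (intro integrable_mult_left integrable_real_indicator) (auto simp: emeasure_eq_measure)
  have "AE x in M. indicator D x * ln (h x) \<le> indicator D x * (I / prob D - 1)"
    using h(1)
  proof eventually_elim
    case (elim x)
    show ?case
    proof (cases "x \<in> D")
      case True
      then have "ln (h x) \<le> I / prob D - 1"
        using lt[OF True elim] D(2) by (simp add: field_simps)
      then show ?thesis using True by simp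
    qed simp
  qed
  then have "I \<le> (\<integral>x. indicator D x * (I / prob D - 1) \<partial>M)"
    unfolding I_def by (rule integral_mono_AE[OF int int'[unfolded I_def]])
  also have "\<dots> = prob D * (I / prob D - 1)" using D(1) by (subst integral_mult_left_zero) simp
  also have "\<dots> = I - prob D" using D(2) by (simp add: field_simps)
  finally show False using D(2) by simp
qed

lemma sum_support_integral:
  fixes h :: "'a \<Rightarrow> real"
  assumes f: "simple_function M f" and h: "integrable M h"
  shows "(\<Sum>y\<in>support M f. \<integral>x. indicator (f -` {y}) x * h x \<partial>M) = (\<integral>x. h x \<partial>M)"
proof -
  note fib = fibre_sets[OF space_UNIV f]
  have "(\<Sum>y\<in>support M f. \<integral>x. indicator (f -` {y}) x * h x \<partial>M)
      = (\<Sum>y\<in>range f. \<integral>x. indicator (f -` {y}) x * h x \<partial>M)"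
  proof (rule sum.mono_neutral_left)
    show "\<forall>y\<in>range f - support M f. (\<integral>x. indicator (f -` {y}) x * h x \<partial>M) = 0"
    proof
      fix y assume "y \<in> range f - support M f"
      then have "prob (f -` {y}) = 0"
        using measure_nonneg[of M "f -` {y}"] by (auto simp: support_def simp del: measure_nonneg)
      then have "f -` {y} \<in> null_sets M" using fib by (auto simp: emeasure_eq_measure)
      then have "AE x in M. x \<notin> f -` {y}" by (rule AE_not_in)
      then have "AE x in M. indicator (f -` {y}) x * h x = 0" by eventually_elim simp
      then show "(\<integral>x. indicator (f -` {y}) x * h x \<partial>M) = 0" by (rule integral_eq_zero_AE)
    qed
  qed (use finite_range_simple[OF space_UNIV f] in \<open>auto simp: support_def\<close>)
  also have "\<dots> = (\<integral>x. (\<Sum>y\<in>range f. indicator (f -` {y}) x * h x) \<partial>M)"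
    using integrable_mult_indicator[OF fib h]
    by (intro Bochner_Integration.integral_sum[symmetric]) simp
  also have "\<dots> = (\<integral>x. h x \<partial>M)"
    using finite_range_simple[OF space_UNIV f]
    by (intro Bochner_Integration.integral_cong) (simp_all add: indicator_def if_distrib cong: if_cong)
  finally show ?thesis .
qed

lemma funpow_block: "(T ^^ N) ^^ k = T ^^ (k * N)"
  by (simp add: funpow_mult mult.commute)

end

text \<open>The second label marks a visit to the exceptional set; \<open>Y k\<close> contains the only core that
  meets a given small ball at time \<open>k\<close>.\<close>

lemma itinerary_weight_bound:
  fixes R :: "'r set"
  assumes R: "finite R" "R \<noteq> {}"
    and Y: "\<And>k. k < n \<Longrightarrow> Y k \<subseteq> R \<and> card (Y k) \<le> 1"
    and G: "G \<subseteq> PiE {..<n} (\<lambda>k. R \<times> {True} \<union> Y k \<times> {False})"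
  shows "(\<Sum>c\<in>G. \<Prod>k<n. if snd (c k) then 1 / real (card R) else 1) \<le> 2 ^ n"
proof -
  let ?w = "\<lambda>p :: 'r \<times> bool. if snd p then 1 / real (card R) else 1"
  let ?B = "\<lambda>k. R \<times> {True} \<union> Y k \<times> {False}"
  have fY: "finite (Y k)" if "k < n" for k using Y[OF that] R(1) finite_subset by blast
  have fB: "finite (?B k)" if "k < n" for k using R(1) fY[OF that] by auto
  have "(\<Sum>c\<in>G. \<Prod>k<n. ?w (c k)) \<le> (\<Sum>c\<in>PiE {..<n} ?B. \<Prod>k<n. ?w (c k))"
    using fB by (intro sum_mono2 G finite_PiE prod_nonneg) auto
  \<comment> \<open>The weight is a product over times, so the sum over the product set factors.
    Each factor collects \<open>card R\<close> labels of weight 1 / card R, and at most one label of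
    weight 1.\<close>
  also have "\<dots> = (\<Prod>k<n. \<Sum>p\<in>?B k. ?w p)"
    using fB by (intro prod_sum_PiE[symmetric]) auto
  also have "\<dots> \<le> (\<Prod>k<n. 2)"
  proof (rule prod_mono, rule conjI)
    fix k assume "k \<in> {..<n}"
    then have k: "k < n" by simp
    show "0 \<le> (\<Sum>p\<in>?B k. ?w p)" by (intro sum_nonneg) auto
    have "(\<Sum>p\<in>?B k. ?w p) = (\<Sum>p\<in>R \<times> {True}. ?w p) + (\<Sum>p\<in>Y k \<times> {False}. ?w p)"
      using R(1) fY[OF k] by (intro sum.union_disjoint) auto
    also have "(\<Sum>p\<in>R \<times> {True}. ?w p) = (\<Sum>p\<in>R \<times> {True}. 1 / real (card R))"
      by (intro sum.cong) auto
    also have "\<dots> = 1" using R by (simp add: card_cartesian_product)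
    also have "(\<Sum>p\<in>Y k \<times> {False}. ?w p) = (\<Sum>p\<in>Y k \<times> {False}. 1)"
      by (intro sum.cong) auto
    also have "\<dots> = real (card (Y k))" by (simp add: card_cartesian_product)
    also have "\<dots> \<le> 1" using Y[OF k] by simp
    finally show "(\<Sum>p\<in>?B k. ?w p) \<le> 2" by simp
  qed
  also have "\<dots> = 2 ^ n" by simp
  finally show ?thesis .
qed

text \<open>A visit outside the cores will be charged ln K, with K the number of labels. The
  exceptional set is made so small that the mean charge per block is at most 1.\<close>

lemma closed_cores:
  fixes M :: "'a::metric_space measure" and u :: "'a \<Rightarrow> 'b"
  assumes "prob_space M" "sets M = sets borel" and u: "simple_function M u"
  obtains C where "\<And>y. closed (C y)" "\<And>y. C y \<subseteq> u -` {y}"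
    "measure M (- (\<Union>y\<in>range u. C y)) * ln (real (card (range u))) \<le> 1"
proof -
  interpret prob_space M by fact
  have sp: "space M = UNIV" using sets_eq_imp_space_eq[OF assms(2)] by simp
  define K where "K = real (card (range u))"
  have fin: "finite (range u)" by (rule finite_range_simple[OF sp u])
  then have K: "K \<ge> 1" by (simp add: K_def Suc_le_eq card_gt_0_iff)
  have pos: "ln K + 1 > 0" using ln_ge_zero[OF K] by simp
  \<comment> \<open>Summed over the K fibres, e gives measure at most 1 / (ln K + 1). The added 1
    avoids a zero denominator when K = 1.\<close>
  define e where "e = 1 / (K * (ln K + 1))"
  have "e > 0" using K pos by (simp add: e_def)
  then have "\<exists>C. closed C \<and> C \<subseteq> u -` {y} \<and> measure M (u -` {y} - C) \<le> e" for y
  proof -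
    obtain C U where "closed C" "open U" "C \<subseteq> u -` {y}" "u -` {y} \<subseteq> U" "measure M (U - C) < e"
      using closed_open_approximation[OF finite_measure_axioms assms(2) fibre_sets[OF sp u] \<open>e > 0\<close>, of "{y}"]
      by blast
    moreover have "measure M (u -` {y} - C) \<le> measure M (U - C)"
      using calculation assms(2) by (intro finite_measure_mono) auto
    ultimately show ?thesis by (intro exI[of _ C]) auto
  qed
  then obtain C where C: "\<And>y. closed (C y)" "\<And>y. C y \<subseteq> u -` {y}"
    "\<And>y. measure M (u -` {y} - C y) \<le> e" by metis
  have D: "u -` {y} - C y \<in> sets M" for y
    using fibre_sets[OF sp u, of "{y}"] C(1)[of y] assms(2) by auto
  have "measure M (- (\<Union>y\<in>range u. C y)) \<le> measure M (\<Union>y\<in>range u. u -` {y} - C y)"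
    using D fin by (intro finite_measure_mono sets.finite_UN) auto
  also have "\<dots> \<le> (\<Sum>y\<in>range u. measure M (u -` {y} - C y))"
    using D fin by (intro finite_measure_subadditive_finite) auto
  also have "\<dots> \<le> (\<Sum>y\<in>range u. e)" by (intro sum_mono C(3))
  also have "\<dots> = 1 / (ln K + 1)" using K by (simp add: K_def e_def)
  finally have "measure M (- (\<Union>y\<in>range u. C y)) * ln K \<le> 1 / (ln K + 1) * ln K"
    using K by (intro mult_right_mono) auto
  also have "\<dots> \<le> 1" using pos by (simp add: field_simps)
  finally show thesis by (intro that[OF C(1,2)]) (simp add: K_def)
qed

text \<open>The loss has three sources: ln 2 per block from the weight carried by a Bowen ball, 1
  per block from the mean charge for visits to the exceptional set, and a single 1 from replacing
  conditional means of ln h by values at representative points.\<close>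

lemma block_entropy_bound:
  fixes M :: "'a::metric_space measure" and g :: "'a \<Rightarrow> 'b" and h :: "'a \<Rightarrow> real" and N :: nat
    and T :: "'a \<Rightarrow> 'a"
  defines "u \<equiv> itinerary T g N"
  assumes inv: "invariant_prob M T" and borel: "sets M = sets borel"
    and g: "simple_function M g" and N: "N \<ge> 1" and n: "n \<ge> 1"
    and C: "\<And>y. closed (C y)" "\<And>y. C y \<subseteq> u -` {y}"
      "measure M (- (\<Union>y\<in>range u. C y)) * ln (real (card (range u))) \<le> 1"
    and \<epsilon>: "\<epsilon> > 0" "\<And>y z a b. y \<in> range u \<Longrightarrow> z \<in> range u \<Longrightarrow> a \<in> C y \<Longrightarrow> b \<in> C z \<Longrightarrow> y \<noteq> z \<Longrightarrow> 2 * \<epsilon> < dist a b"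
    and h: "\<And>x. h x \<ge> 0" "AE x in M. h x > 0" "integrable M (\<lambda>x. ln (h x))"
  shows "\<exists>E. finite E \<and> separated T (n * N) \<epsilon> E \<and> (\<Sum>x\<in>E. h x) > 0 \<and>
    shannon M (itinerary T g (n * N)) + (\<integral>x. ln (h x) \<partial>M) - real n * (ln 2 + 1) - 1 \<le> ln (\<Sum>x\<in>E. h x)"
proof -
  interpret invariant_prob M T by fact
  interpret S: invariant_prob M "T ^^ N" by (rule invariant_prob_funpow)
  define R K where "R = range u" and "K = real (card R)"
  define B0 where "B0 = - (\<Union>y\<in>range u. C y)"
  \<comment> \<open>The label keeps the value of \<open>u\<close> on \<open>B0\<close> too;
    therefore \<open>d\<close> determines the full \<open>g\<close>-itinerary of length n N, and its
    entropy is at least as large.\<close>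
  define v where "v x = (u x, x \<in> B0)" for x
  define d where "d = itinerary (T ^^ N) v n"
  define w where "w c = (\<Prod>k<n. if snd (c k) then 1 / K else 1)" for c :: "nat \<Rightarrow> (nat \<Rightarrow> 'b) \<times> bool"
  have u: "simple_function M u" unfolding u_def by (rule simple_function_itinerary[OF g])
  have R: "finite R" "R \<noteq> {}" unfolding R_def using finite_range_simple[OF space_UNIV u] by auto
  then have K: "K \<ge> 1" by (simp add: K_def Suc_le_eq card_gt_0_iff)
  have B0: "B0 \<in> sets M"
    unfolding B0_def borel using R(1) C(1) by (intro borel_open open_Compl closed_UN) (auto simp: R_def)
  have v: "simple_function M v"
    unfolding v_def[abs_def]
  proof (intro simple_function_Pair u)
    have "{z. (z \<in> B0) = (x \<in> B0)} = (if x \<in> B0 then B0 else space M - B0)" for x by auto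
    then show "simple_function M (\<lambda>x. x \<in> B0)"
      using B0 sets.compl_sets[OF B0] by (auto simp: simple_function_def vimage_def intro: finite_subset[of _ UNIV])
  qed
  have d: "simple_function M d" unfolding d_def by (rule S.simple_function_itinerary[OF v])
  have dk: "d x k = (u ((T ^^ (k * N)) x), (T ^^ (k * N)) x \<in> B0)" if "k < n" for x k
    using that by (simp add: d_def itinerary_def v_def funpow_block)
  let ?F = "support M d"
  have fib: "d -` {c} \<in> sets M" for c by (rule fibre_sets[OF space_UNIV d])
  have "\<forall>c\<in>?F. \<exists>x. d x = c \<and> h x > 0 \<and> (\<integral>x. indicator (d -` {c}) x * ln (h x) \<partial>M) \<le> prob (d -` {c}) * (ln (h x) + 1)"
  proof
    fix c assume "c \<in> ?F"
    then have "prob (d -` {c}) > 0" by (simp add: support_def)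
    from point_above_average[OF fib this h(2,3)] obtain x where x: "x \<in> d -` {c}" "h x > 0"
      "(\<integral>x. indicator (d -` {c}) x * ln (h x) \<partial>M) \<le> prob (d -` {c}) * (ln (h x) + 1)" by (elim bexE conjE)
    from x(1) have "d x = c" by simp
    with x(2,3) show "\<exists>x. d x = c \<and> h x > 0 \<and> (\<integral>x. indicator (d -` {c}) x * ln (h x) \<partial>M) \<le> prob (d -` {c}) * (ln (h x) + 1)"
      by (intro exI[of _ x] conjI)
  qed
  from bchoice[OF this] obtain p where p: "\<And>c. c \<in> ?F \<Longrightarrow> d (p c) = c" "\<And>c. c \<in> ?F \<Longrightarrow> h (p c) > 0"
    "\<And>c. c \<in> ?F \<Longrightarrow> (\<integral>x. indicator (d -` {c}) x * ln (h x) \<partial>M) \<le> prob (d -` {c}) * (ln (h (p c)) + 1)"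
    by blast
  have w: "w c > 0" for c unfolding w_def using K by (intro prod_pos) auto
  \<comment> \<open>The factor \<open>exp 1\<close> compensates for the slack 1 in the choice of
    \<open>p c\<close>.\<close>
  define q where "q c = w c * (exp 1 * h (p c))" for c
  have q: "q c > 0" if "c \<in> ?F" for c using p(2)[OF that] w by (simp add: q_def)
  note fF = finite_support[OF space_UNIV d]

  have near: "\<exists>E\<subseteq>?F. (\<forall>i\<in>E. \<forall>j\<in>E. i \<noteq> j \<longrightarrow> \<not> bowen_dist T (n * N) (p i) (p j) \<le> \<epsilon>) \<and>
    (\<Sum>c\<in>?F. w c * h (p c)) \<le> 2 ^ n * (\<Sum>c\<in>E. h (p c))"
  proof (rule greedy_independent_subset[OF fF])
    fix j assume j: "j \<in> ?F"
    let ?G = "{c \<in> ?F. bowen_dist T (n * N) (p j) (p c) \<le> \<epsilon>}"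
    define Y where "Y k = {y \<in> R. \<exists>z\<in>C y. dist ((T ^^ (k * N)) (p j)) z \<le> \<epsilon>}" for k
    have "card (Y k) \<le> 1" for k
    proof -
      have "y = y'" if y: "y \<in> Y k" "y' \<in> Y k" for y y'
      proof (rule ccontr)
        assume "y \<noteq> y'"
        from y obtain z z' where z: "z \<in> C y" "z' \<in> C y'" "y \<in> R" "y' \<in> R"
          "dist ((T ^^ (k * N)) (p j)) z \<le> \<epsilon>" "dist ((T ^^ (k * N)) (p j)) z' \<le> \<epsilon>"
          by (auto simp: Y_def)
        have "dist z z' \<le> 2 * \<epsilon>"
          using dist_triangle3[of z z' "(T ^^ (k * N)) (p j)"] z(5,6) by simp
        moreover have "2 * \<epsilon> < dist z z'" using z \<open>y \<noteq> y'\<close> by (intro \<epsilon>(2)) (auto simp: R_def)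
        ultimately show False by simp
      qed
      then show ?thesis using R(1) by (subst One_nat_def, subst card_le_Suc0_iff_eq) (auto simp: Y_def)
    qed
    then have Y: "Y k \<subseteq> R \<and> card (Y k) \<le> 1" for k by (auto simp: Y_def)
    have "?G \<subseteq> PiE {..<n} (\<lambda>k. R \<times> {True} \<union> Y k \<times> {False})"
    proof (intro subsetI PiE_I)
      fix c k assume c: "c \<in> ?G" and "k \<in> {..<n}"
      then have k: "k < n" and ck: "c k = (u ((T ^^ (k * N)) (p c)), (T ^^ (k * N)) (p c) \<in> B0)"
        using dk[of k "p c"] p(1)[of c] by auto
      let ?z = "(T ^^ (k * N)) (p c)"
      show "c k \<in> R \<times> {True} \<union> Y k \<times> {False}"
      proof (cases "?z \<in> B0")
        case False
        then obtain y where y: "?z \<in> C y" by (auto simp: B0_def)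
        then have "u ?z = y" using C(2)[of y] by auto
        moreover have "k * N < n * N" using k N by simp
        then have "dist ((T ^^ (k * N)) (p j)) ?z \<le> \<epsilon>"
          using bowen_dist_ge[of "k * N" "n * N" T "p j" "p c"] c by simp
        ultimately show ?thesis using False y unfolding ck by (auto simp: Y_def R_def)
      qed (simp add: ck R_def)
    next
      fix c k assume c: "c \<in> ?G" and k: "k \<notin> {..<n}"
      then have "c k = d (p c) k" using p(1)[of c] by simp
      also have "\<dots> = undefined" using k by (simp add: d_def itinerary_def)
      finally show "c k = undefined" .
    qed
    then show "(\<Sum>c\<in>?G. w c) \<le> 2 ^ n"
      unfolding w_def K_def by (rule itinerary_weight_bound[OF R Y])
  next
    \<comment> \<open>At length 0 the Bowen distance would be the maximum of an empty set; at
      positive length every point has distance 0 to itself, which makes nearness reflexive.\<close>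
    have "1 \<le> n * N" using n N by simp
    then show "bowen_dist T (n * N) (p i) (p i) \<le> \<epsilon>" for i
      using \<epsilon>(1) by (simp add: bowen_dist_self)
  qed (use p(2) w in \<open>auto simp: bowen_dist_commute less_imp_le\<close>)
  then obtain E where E: "E \<subseteq> ?F" "\<And>i j. i \<in> E \<Longrightarrow> j \<in> E \<Longrightarrow> i \<noteq> j \<Longrightarrow> bowen_dist T (n * N) (p i) (p j) > \<epsilon>"
    "(\<Sum>c\<in>?F. w c * h (p c)) \<le> 2 ^ n * (\<Sum>c\<in>E. h (p c))"
    by (auto simp: not_le)
  have inj: "inj_on p E"
  proof (rule inj_onI)
    fix i j assume "i \<in> E" "j \<in> E" "p i = p j" then show "i = j" using p(1) E(1) by (metis subsetD)
  qed
  have sep: "separated T (n * N) \<epsilon> (p ` E)" unfolding separated_def using E(2) by fastforce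
  have sum: "(\<Sum>x\<in>p ` E. h x) = (\<Sum>c\<in>E. h (p c))" by (simp add: sum.reindex[OF inj])
  have "?F \<noteq> {}" using sum_support_prob[OF space_UNIV d] by auto
  then have "(\<Sum>c\<in>?F. w c * h (p c)) > 0" using w p(2) by (intro sum_pos fF) auto
  then have pos: "(\<Sum>c\<in>E. h (p c)) > 0"
    using E(3) by (smt (verit) mult_nonneg_nonpos zero_le_power)

  have "(\<Sum>c\<in>?F. q c) = exp 1 * (\<Sum>c\<in>?F. w c * h (p c))"
    by (simp add: q_def sum_distrib_left mult_ac)
  also have "\<dots> \<le> exp 1 * (2 ^ n * (\<Sum>c\<in>E. h (p c)))" using E(3) by simp
  finally have "ln (\<Sum>c\<in>?F. q c) \<le> ln (exp 1 * (2 ^ n * (\<Sum>c\<in>E. h (p c))))"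
    using sum_pos[OF fF \<open>?F \<noteq> {}\<close> q] by (intro ln_mono) auto
  also have "\<dots> = 1 + (real n * ln 2 + ln (\<Sum>c\<in>E. h (p c)))"
    using pos by (simp add: ln_mult ln_realpow)
  finally have ub: "ln (\<Sum>c\<in>?F. q c) \<le> 1 + (real n * ln 2 + ln (\<Sum>c\<in>E. h (p c)))" .

  \<comment> \<open>Every visit to \<open>B0\<close> at a block start contributes - ln K. By
    invariance each of the n times contributes the mean - prob B0 * ln K, which is at least -1 by
    the choice of the cores.\<close>
  have lnw: "ln (w (d x)) = (\<Sum>k<n. - ln K * indicator B0 ((T ^^ (k * N)) x))" for x
    unfolding w_def using K
    by (subst ln_prod) (auto intro!: sum.cong simp: dk ln_div)
  have int_B0: "integrable M (\<lambda>x. indicator B0 ((T ^^ j) x) :: real)" for j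
    using B0 by (intro integrable_funpow integrable_real_indicator) (auto simp: emeasure_eq_measure)
  have "(\<integral>x. ln (w (d x)) \<partial>M) = (\<Sum>k<n. - ln K * (\<integral>x. indicator B0 ((T ^^ (k * N)) x) \<partial>M))"
    unfolding lnw using int_B0 by (subst Bochner_Integration.integral_sum) auto
  also have "\<dots> = (\<Sum>k<n. - (prob B0 * ln K))"
    using B0 by (intro sum.cong) (auto simp: integral_funpow[of "indicator B0"])
  also have "\<dots> \<ge> (\<Sum>k<n. - 1)"
    using C(3) by (intro sum_mono) (simp add: B0_def K_def R_def)
  finally have lw: "(\<integral>x. ln (w (d x)) \<partial>M) \<ge> - real n" by simp

  \<comment> \<open>The integral of ln h is split over the cells of \<open>d\<close>; on each cell
    the choice of \<open>p c\<close> bounds it by the probability of the cell times ln (h (p c)) +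
    1.\<close>
  have "(\<integral>x. ln (w (d x)) \<partial>M) + (\<integral>x. ln (h x) \<partial>M)
      = (\<Sum>c\<in>?F. prob (d -` {c}) * ln (w c) + (\<integral>x. indicator (d -` {c}) x * ln (h x) \<partial>M))"
    by (simp add: sum.distrib sum_support_integral[OF d h(3)]
        has_integral_label(2)[OF space_UNIV d, of "\<lambda>c. ln (w c)"])
  also have "\<dots> \<le> (\<Sum>c\<in>?F. prob (d -` {c}) * ln (q c))"
  proof (rule sum_mono)
    fix c assume c: "c \<in> ?F"
    have "ln (q c) = ln (w c) + (ln (h (p c)) + 1)"
      using w[of c] p(2)[OF c] by (simp add: q_def ln_mult)
    then show "prob (d -` {c}) * ln (w c) + (\<integral>x. indicator (d -` {c}) x * ln (h x) \<partial>M) \<le> prob (d -` {c}) * ln (q c)"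
      using p(3)[OF c] by (simp add: distrib_left)
  qed
  also have "\<dots> = (\<integral>x. ln (q (d x)) \<partial>M)"
    by (simp add: has_integral_label(2)[OF space_UNIV d, of "\<lambda>c. ln (q c)"])
  finally have "shannon M d - real n + (\<integral>x. ln (h x) \<partial>M) \<le> shannon M d + (\<integral>x. ln (q (d x)) \<partial>M)"
    using lw by simp
  also have "\<dots> \<le> ln (\<Sum>c\<in>?F. q c)" by (rule shannon_gibbs[OF space_UNIV d q])
  finally have main: "shannon M d - real n + (\<integral>x. ln (h x) \<partial>M) \<le> 1 + (real n * ln 2 + ln (\<Sum>c\<in>E. h (p c)))"
    using ub by simp

  have "shannon M (itinerary T g (n * N)) \<le> shannon M d"
  proof (rule shannon_refine[OF space_UNIV simple_function_itinerary[OF g] d])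
    fix x y assume eq: "d x = d y"
    have "g ((T ^^ j) x) = g ((T ^^ j) y)" if j: "j < n * N" for j
    proof -
      have k: "j div N < n" using j by (simp add: less_mult_imp_div_less)
      have i: "j mod N < N" using N by simp
      have "u ((T ^^ (j div N * N)) x) = u ((T ^^ (j div N * N)) y)"
        using dk[OF k, of x] dk[OF k, of y] eq by simp
      then have "g ((T ^^ (j mod N)) ((T ^^ (j div N * N)) x)) = g ((T ^^ (j mod N)) ((T ^^ (j div N * N)) y))"
        using i by (simp add: u_def itinerary_eq_iff)
      moreover have "(T ^^ (j mod N)) ((T ^^ (j div N * N)) z) = (T ^^ j) z" for z
        by (metis comp_apply funpow_add mod_div_mult_eq)
      ultimately show ?thesis by simp
    qed
    then show "itinerary T g (n * N) x = itinerary T g (n * N) y" by (simp add: itinerary_eq_iff)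
  qed
  then have "shannon M (itinerary T g (n * N)) + (\<integral>x. ln (h x) \<partial>M) - real n * (ln 2 + 1) - 1 \<le> ln (\<Sum>c\<in>E. h (p c))"
    using main by (simp add: algebra_simps)
  then show ?thesis
    using sep pos finite_subset[OF E(1) fF] by (intro exI[of _ "p ` E"]) (simp add: sum)
qed

section \<open>Entropy, exponents and pressure\<close>

text \<open>The scale \<epsilon> depends on N, which is harmless because pressure dominates every
  scale. For fixed N the block bound is divided by n N and n tends to infinity along the multiples
  of N, a subsequence of the upper limit; only then does N grow.\<close>

lemma entropy_rate_plus_exponent_le_pressure:
  fixes M :: "'a::metric_space measure" and g :: "'a \<Rightarrow> 'b" and \<psi> :: "nat \<Rightarrow> 'a \<Rightarrow> real"
  assumes X: "compact (UNIV :: 'a set)" and inv: "invariant_prob M T" and borel: "sets M = sets borel"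
    and g: "simple_function M g"
    and \<psi>: "\<And>n x. n \<ge> 1 \<Longrightarrow> \<psi> n x \<ge> 0" "\<And>n. n \<ge> 1 \<Longrightarrow> AE x in M. \<psi> n x > 0"
      "\<And>n. n \<ge> 1 \<Longrightarrow> integrable M (\<lambda>x. ln (\<psi> n x))"
    and c: "(\<lambda>n. (\<integral>x. ln (\<psi> n x) \<partial>M) / real n) \<longlonglongrightarrow> c"
  shows "ereal (lim (\<lambda>n. shannon M (itinerary T g n) / real n) + c) \<le> pressure T \<psi>"
proof -
  interpret invariant_prob M T by fact
  define H I where "H n = shannon M (itinerary T g n)" and "I n = (\<integral>x. ln (\<psi> n x) \<partial>M)" for n
  define r where "r = lim (\<lambda>n. H n / real n)"
  have r: "(\<lambda>n. H n / real n) \<longlonglongrightarrow> r"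
    using partition_entropy_rate_limit[OF g] by (simp add: convergent_LIMSEQ_iff r_def H_def)
  have bound: "ereal (r + c - (ln 2 + 1) * (1 / real N)) \<le> pressure T \<psi>" if N: "N \<ge> 1" for N
  proof -
    let ?u = "itinerary T g N"
    have u: "simple_function M ?u" by (rule simple_function_itinerary[OF g])
    obtain C where C: "\<And>y. closed (C y)" "\<And>y. C y \<subseteq> ?u -` {y}"
      "prob (- (\<Union>y\<in>range ?u. C y)) * ln (real (card (range ?u))) \<le> 1"
      using closed_cores[OF prob_space_axioms borel u] by blast
    have "\<exists>\<epsilon>>0. \<forall>y\<in>range ?u. \<forall>z\<in>range ?u. \<forall>a\<in>C y. \<forall>b\<in>C z. y \<noteq> z \<longrightarrow> 2 * \<epsilon> < dist a b"
    proof (rule closed_family_separation[OF X finite_range_simple[OF space_UNIV u] C(1)])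
      fix y z :: "nat \<Rightarrow> 'b" assume "y \<noteq> z"
      then show "C y \<inter> C z = {}" using C(2)[of y] C(2)[of z] by blast
    qed
    then obtain \<epsilon> where \<epsilon>: "\<epsilon> > 0"
      "\<And>y z a b. y \<in> range ?u \<Longrightarrow> z \<in> range ?u \<Longrightarrow> a \<in> C y \<Longrightarrow> b \<in> C z \<Longrightarrow> y \<noteq> z \<Longrightarrow> 2 * \<epsilon> < dist a b"
      by blast
    \<comment> \<open>The block bound divided by n N; the last term comes from the single additive 1
      and vanishes as n grows, the one before it only as N grows.\<close>
    define Y where "Y n = H (n * N) / real (n * N) + I (n * N) / real (n * N)
      - ((ln 2 + 1) * (1 / real N) + 1 / real N * (1 / real n))" for n
    let ?Z = "\<lambda>n. ereal (1 / real n) * ereal_log (separated_sum T \<psi> \<epsilon> n)"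
    have "ereal (Y n) \<le> ?Z (n * N)" if n: "n \<ge> 1" for n
    proof -
      have nN: "n * N \<ge> 1" using n N by simp
      have "\<exists>E. finite E \<and> separated T (n * N) \<epsilon> E \<and> (\<Sum>x\<in>E. \<psi> (n * N) x) > 0 \<and>
          H (n * N) + I (n * N) - real n * (ln 2 + 1) - 1 \<le> ln (\<Sum>x\<in>E. \<psi> (n * N) x)"
        unfolding H_def I_def
        by (rule block_entropy_bound[OF inv borel g N n C \<epsilon> \<psi>(1)[OF nN] \<psi>(2,3)[OF nN]])
      then obtain E where E: "finite E" "separated T (n * N) \<epsilon> E" "(\<Sum>x\<in>E. \<psi> (n * N) x) > 0"
        "H (n * N) + I (n * N) - real n * (ln 2 + 1) - 1 \<le> ln (\<Sum>x\<in>E. \<psi> (n * N) x)"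
        by (elim exE conjE)
      have "ereal (ln (\<Sum>x\<in>E. \<psi> (n * N) x)) = ereal_log (ereal (\<Sum>x\<in>E. \<psi> (n * N) x))"
        by (rule ereal_log_real[symmetric, OF E(3)])
      also have "\<dots> \<le> ereal_log (separated_sum T \<psi> \<epsilon> (n * N))"
        unfolding separated_sum_def using E by (intro ereal_log_mono SUP_upper) auto
      finally have "ereal (H (n * N) + I (n * N) - real n * (ln 2 + 1) - 1) \<le> ereal_log (separated_sum T \<psi> \<epsilon> (n * N))"
        using E(4) by (metis order_trans ereal_less_eq(3))
      then have "ereal (1 / real (n * N)) * ereal (H (n * N) + I (n * N) - real n * (ln 2 + 1) - 1) \<le> ?Z (n * N)"
        by (intro ereal_mult_left_mono) auto
      moreover have "1 / real (n * N) * (H (n * N) + I (n * N) - real n * (ln 2 + 1) - 1) = Y n"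
        using n N by (simp add: Y_def field_simps)
      ultimately show ?thesis by simp
    qed
    then have ev: "eventually (\<lambda>n. ereal (Y n) \<le> ?Z (n * N)) sequentially"
      by (rule eventually_sequentiallyI[of 1])
    have sub: "strict_mono (\<lambda>n. n * N)" using N by (auto simp: strict_mono_def)
    have "Y \<longlonglongrightarrow> r + c - ((ln 2 + 1) * (1 / real N) + 1 / real N * 0)"
      unfolding Y_def I_def
      using LIMSEQ_subseq_LIMSEQ[OF r sub] LIMSEQ_subseq_LIMSEQ[OF c sub]
      by (intro tendsto_intros lim_1_over_n) (simp_all add: comp_def)
    then have "(\<lambda>n. ereal (Y n)) \<longlonglongrightarrow> ereal (r + c - (ln 2 + 1) * (1 / real N))"
      by simp
    then have "ereal (r + c - (ln 2 + 1) * (1 / real N)) = limsup (\<lambda>n. ereal (Y n))"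
      by (intro lim_imp_Limsup[symmetric]) auto
    also have "\<dots> \<le> limsup (\<lambda>n. ?Z (n * N))" by (rule Limsup_mono[OF ev])
    also have "\<dots> \<le> limsup ?Z" using limsup_subseq_mono[OF sub, of ?Z] by (simp add: comp_def)
    also have "\<dots> \<le> pressure T \<psi>"
      unfolding pressure_eq_SUP pressure_at_scale_def[symmetric] using \<epsilon>(1) by (intro SUP_upper) auto
    finally show ?thesis .
  qed
  have "(\<lambda>N. r + c - (ln 2 + 1) * (1 / real N)) \<longlonglongrightarrow> r + c - (ln 2 + 1) * 0"
    by (intro tendsto_intros lim_1_over_n)
  then have "(\<lambda>N. ereal (r + c - (ln 2 + 1) * (1 / real N))) \<longlonglongrightarrow> ereal (r + c)"
    by simp
  then have "ereal (r + c) \<le> pressure T \<psi>"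
    by (rule LIMSEQ_le_const2) (use bound in blast)
  then show ?thesis by (simp only: r_def H_def)
qed

section \<open>Integrals of extended logarithms\<close>

definition log_integral :: "'a measure \<Rightarrow> ('a \<Rightarrow> real) \<Rightarrow> ereal" where
  "log_integral M h = ereal_integral M (\<lambda>x. ereal_log (ereal (h x)))"

lemma borel_measurable_ereal_log [measurable]: "ereal_log \<in> borel_measurable borel"
  unfolding ereal_log_def by measurable

context prob_space begin

lemma log_integral_eq:
  assumes pos: "AE x in M. h x > 0" and int: "integrable M (\<lambda>x. ln (h x))"
  shows "log_integral M h = ereal (\<integral>x. ln (h x) \<partial>M)"
proof -
  have p: "(\<integral>\<^sup>+x. e2ennreal (ereal_log (ereal (h x))) \<partial>M) = (\<integral>\<^sup>+x. ennreal (ln (h x)) \<partial>M)"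
    using pos by (intro nn_integral_cong_AE) (auto elim!: eventually_mono simp: ereal_log_real ennreal.abs_eq e2ennreal_ereal)
  have m: "(\<integral>\<^sup>+x. e2ennreal (- ereal_log (ereal (h x))) \<partial>M) = (\<integral>\<^sup>+x. ennreal (- ln (h x)) \<partial>M)"
    using pos by (intro nn_integral_cong_AE) (auto elim!: eventually_mono simp: ereal_log_real e2ennreal_ereal)
  have fin: "(\<integral>\<^sup>+x. ennreal (ln (h x)) \<partial>M) \<noteq> \<infinity>" "(\<integral>\<^sup>+x. ennreal (- ln (h x)) \<partial>M) \<noteq> \<infinity>"
    using int by (auto simp: real_integrable_def)
  show ?thesis
    unfolding log_integral_def ereal_integral_def p m real_lebesgue_integral_def[OF int]
    using fin by (cases "\<integral>\<^sup>+x. ennreal (ln (h x)) \<partial>M"; cases "\<integral>\<^sup>+x. ennreal (- ln (h x)) \<partial>M") auto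
qed

text \<open>The upper bound on h makes the positive part integrable, so a value other than -inf
  forces the negative part to be finite. The extended logarithm is then finite almost everywhere,
  which means h > 0.\<close>

lemma log_integral_neq_MInf:
  assumes h [measurable]: "h \<in> borel_measurable M" and nonneg: "\<And>x. h x \<ge> 0" and le: "\<And>x. h x \<le> B"
    and neq: "log_integral M h \<noteq> -\<infinity>"
  shows "AE x in M. h x > 0" and "integrable M (\<lambda>x. ln (h x))"
proof -
  have "(\<integral>\<^sup>+x. e2ennreal (ereal_log (ereal (h x))) \<partial>M) \<le> (\<integral>\<^sup>+x. ennreal \<bar>ln B\<bar> \<partial>M)"
  proof (intro nn_integral_mono)
    fix x
    show "e2ennreal (ereal_log (ereal (h x))) \<le> ennreal \<bar>ln B\<bar>"
    proof (cases "h x = 0")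
      case False
      then have "h x > 0" "B > 0" using nonneg[of x] le[of x] by auto
      then have "ln (h x) \<le> \<bar>ln B\<bar>" by (intro order_trans[OF ln_mono[OF le[of x]] abs_ge_self])
      then show ?thesis using \<open>h x > 0\<close> by (simp add: ereal_log_real e2ennreal_ereal ennreal_leI)
    qed (simp add: ereal_log_def e2ennreal_neg)
  qed
  also have "\<dots> < \<infinity>" by (simp add: emeasure_space_1)
  finally have fin_p: "(\<integral>\<^sup>+x. e2ennreal (ereal_log (ereal (h x))) \<partial>M) \<noteq> \<infinity>" by simp
  have fin_m: "(\<integral>\<^sup>+x. e2ennreal (- ereal_log (ereal (h x))) \<partial>M) \<noteq> \<infinity>"
  proof
    assume inf: "(\<integral>\<^sup>+x. e2ennreal (- ereal_log (ereal (h x))) \<partial>M) = \<infinity>"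
    have "log_integral M h = -\<infinity>"
      unfolding log_integral_def ereal_integral_def inf
      using fin_p by (cases "\<integral>\<^sup>+x. e2ennreal (ereal_log (ereal (h x))) \<partial>M") auto
    with neq show False by simp
  qed
  then have "AE x in M. e2ennreal (- ereal_log (ereal (h x))) \<noteq> \<infinity>"
    by (intro nn_integral_noteq_infinite) auto
  then show pos: "AE x in M. h x > 0"
  proof eventually_elim
    case (elim x)
    then have "h x \<noteq> 0" by (auto simp: ereal_log_def)
    then show ?case using nonneg[of x] by simp
  qed
  have "(\<integral>\<^sup>+x. ennreal (ln (h x)) \<partial>M) = (\<integral>\<^sup>+x. e2ennreal (ereal_log (ereal (h x))) \<partial>M)"
    "(\<integral>\<^sup>+x. ennreal (- ln (h x)) \<partial>M) = (\<integral>\<^sup>+x. e2ennreal (- ereal_log (ereal (h x))) \<partial>M)"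
    using pos by (auto intro!: nn_integral_cong_AE elim!: eventually_mono simp: ereal_log_real e2ennreal_ereal)
  then show "integrable M (\<lambda>x. ln (h x))"
    using fin_p fin_m by (simp add: real_integrable_def)
qed

lemma log_integral_le:
  assumes "h \<in> borel_measurable M" "\<And>x. h x \<ge> 0" and le: "\<And>x. h x \<le> B"
  shows "log_integral M h \<le> ereal_log (ereal B)"
proof (cases "log_integral M h = -\<infinity>")
  case False
  note * = log_integral_neq_MInf[OF assms False]
  have ae: "AE x in M. 0 < B \<and> ln (h x) \<le> ln B"
    using *(1) by eventually_elim (metis le less_le_trans ln_mono)
  then have "AE x in M. 0 < B" by eventually_elim simp
  then have "0 < B" by simp
  moreover have "(\<integral>x. ln (h x) \<partial>M) \<le> ln B"
    using ae by (intro integral_le_const *) (auto elim: eventually_mono)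
  ultimately show ?thesis using log_integral_eq[OF *] by (simp add: ereal_log_real)
qed simp

text \<open>From h \<le> f g follows ln f \<ge> ln h - ln B, while ln f \<le> ln A; so ln f lies
  between integrable functions.\<close>

lemma integrable_ln_factor:
  fixes f g h :: "'a \<Rightarrow> real"
  assumes [measurable]: "f \<in> borel_measurable M" "g \<in> borel_measurable M" and "\<And>x. g x \<ge> 0" "\<And>x. g x \<le> B" "\<And>x. f x \<ge> 0" "\<And>x. f x \<le> A"
    and h: "AE x in M. h x > 0" "integrable M (\<lambda>x. ln (h x))" "\<And>x. h x \<le> f x * g x"
  shows "(AE x in M. f x > 0) \<and> integrable M (\<lambda>x. ln (f x))"
proof
  show pos: "AE x in M. f x > 0"
    using h(1)
  proof eventually_elim
    case (elim x)
    then have "f x * g x > 0" using h(3)[of x] by linarith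
    then show ?case using assms(5)[of x] by (auto simp: zero_less_mult_iff)
  qed
  show "integrable M (\<lambda>x. ln (f x))"
  proof (rule Bochner_Integration.integrable_bound)
    show "integrable M (\<lambda>x. \<bar>ln (h x)\<bar> + \<bar>ln A\<bar> + \<bar>ln B\<bar>)"
      using h(2) by auto
    show "AE x in M. norm (ln (f x)) \<le> norm (\<bar>ln (h x)\<bar> + \<bar>ln A\<bar> + \<bar>ln B\<bar>)"
      using h(1) pos
    proof eventually_elim
      case (elim x)
      then have "f x * g x > 0" using h(3)[of x] by linarith
      then have g: "g x > 0" using elim(2) by (auto simp: zero_less_mult_iff)
      have "ln (h x) \<le> ln (f x * g x)" using elim h(3) by (intro ln_mono) auto
      also have "\<dots> = ln (f x) + ln (g x)" using elim g by (simp add: ln_mult)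
      also have "ln (g x) \<le> ln B" using g assms(4) by (intro ln_mono) auto
      finally have "ln (h x) \<le> ln (f x) + ln B" by simp
      moreover have "ln (f x) \<le> ln A" using elim assms(6) by (intro ln_mono) auto
      ultimately show ?case by simp
    qed
  qed auto
qed

text \<open>If the left side is not -inf, both factors inherit positivity and integrability from h,
  and the claim becomes an inequality between real integrals.\<close>

lemma log_integral_mult_le:
  fixes f g h :: "'a \<Rightarrow> real"
  assumes m: "f \<in> borel_measurable M" "g \<in> borel_measurable M" "h \<in> borel_measurable M"
    and f: "\<And>x. f x \<ge> 0" "\<And>x. f x \<le> A" and g: "\<And>x. g x \<ge> 0" "\<And>x. g x \<le> B"
    and h: "\<And>x. h x \<ge> 0" "\<And>x. h x \<le> C" "\<And>x. h x \<le> f x * g x"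
  shows "log_integral M h \<le> log_integral M f + log_integral M g"
proof (cases "log_integral M h = -\<infinity>")
  case False
  note hh = log_integral_neq_MInf[OF m(3) h(1,2) False]
  have ff: "AE x in M. f x > 0" "integrable M (\<lambda>x. ln (f x))"
    using integrable_ln_factor[OF m(1,2) g f hh h(3)] by auto
  have gg: "AE x in M. g x > 0" "integrable M (\<lambda>x. ln (g x))"
    using integrable_ln_factor[OF m(2,1) f g hh] h(3) by (auto simp: mult.commute)
  have "(\<integral>x. ln (h x) \<partial>M) \<le> (\<integral>x. ln (f x) + ln (g x) \<partial>M)"
  proof (rule integral_mono_AE)
    show "AE x in M. ln (h x) \<le> ln (f x) + ln (g x)"
      using hh(1) ff(1) gg(1)
    proof eventually_elim
      case (elim x)
      then show ?case using ln_mono[OF h(3) elim(1)] by (simp add: ln_mult)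
    qed
  qed (use hh ff gg in auto)
  then show ?thesis
    using ff gg by (simp add: log_integral_eq[OF hh] log_integral_eq[OF ff] log_integral_eq[OF gg])
qed simp

text \<open>Monotone convergence as \<open>\<delta> \<rightarrow> 0\<close>: the truncated logarithms are continuous, so they can be
  tested against weak* convergence.\<close>

lemma log_integral_ge_truncations:
  assumes h [measurable]: "h \<in> borel_measurable M" and nonneg: "\<And>x. h x \<ge> 0" and le: "\<And>x. h x \<le> B"
    and trunc: "\<And>\<delta>. \<delta> > 0 \<Longrightarrow> L \<le> (\<integral>x. ln (max (h x) \<delta>) \<partial>M)"
  shows "ereal L \<le> log_integral M h"
proof -
  define A where "A = max B 1"
  \<comment> \<open>The truncation levels exp (- k) decrease to 0. Subtracting from ln A turns the
    decreasing logarithms into nonnegative increasing functions, as monotone convergence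
    requires.\<close>
  define F where "F k x = ennreal (ln A - ln (max (h x) (exp (- real k))))" for k x
  have A: "\<And>x. h x \<le> A" "A \<ge> 1" using le by (simp_all add: A_def le_max_iff_disj)
  have m: "0 < max (h x) (exp (- real k))" "max (h x) (exp (- real k)) \<le> A" for k x
    using A(1)[of x] A(2) by (auto intro: order_trans[of _ 1] simp: less_max_iff_disj)
  have F_le: "(\<integral>\<^sup>+x. F k x \<partial>M) \<le> ennreal (ln A - L)" for k
  proof -
    have int: "integrable M (\<lambda>x. ln (max (h x) (exp (- real k))))"
    proof (rule Bochner_Integration.integrable_bound)
      have "\<bar>ln (max (h x) (exp (- real k)))\<bar> \<le> real k + ln A" for x
      proof -
        have "ln (exp (- real k)) \<le> ln (max (h x) (exp (- real k)))" by (intro ln_mono) auto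
        moreover have "ln (max (h x) (exp (- real k))) \<le> ln A" using m by (intro ln_mono)
        moreover have "ln A \<ge> 0" using A by simp
        ultimately show ?thesis by simp
      qed
      then show "AE x in M. norm (ln (max (h x) (exp (- real k)))) \<le> norm (real k + ln A)" 
        by (intro AE_I2) (auto intro: order_trans[OF _ abs_ge_self])
    qed auto
    have "(\<integral>\<^sup>+x. F k x \<partial>M) = ennreal (\<integral>x. ln A - ln (max (h x) (exp (- real k))) \<partial>M)"
      unfolding F_def using int by (intro nn_integral_eq_integral) (auto intro!: AE_I2 ln_mono[OF m(2) m(1)])
    also have "(\<integral>x. ln A - ln (max (h x) (exp (- real k))) \<partial>M) = ln A - (\<integral>x. ln (max (h x) (exp (- real k))) \<partial>M)"
      using int by (subst Bochner_Integration.integral_diff) (auto simp: prob_space)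
    finally show ?thesis using trunc[of "exp (- real k)"] by (simp add: ennreal_leI)
  qed
  have inc: "incseq F"
    unfolding F_def by (intro incseq_SucI le_funI ennreal_leI diff_left_mono ln_mono max.mono) (auto simp: less_max_iff_disj)
  have Fm: "F k \<in> borel_measurable M" for k unfolding F_def by measurable
  have "(\<integral>\<^sup>+x. (SUP k. F k x) \<partial>M) = (SUP k. \<integral>\<^sup>+x. F k x \<partial>M)"
    by (rule nn_integral_monotone_convergence_SUP[OF inc Fm])
  also have "\<dots> \<le> ennreal (ln A - L)" by (intro SUP_least F_le)
  finally have SUP_le: "(\<integral>\<^sup>+x. (SUP k. F k x) \<partial>M) \<le> ennreal (ln A - L)" .
  then have "(\<integral>\<^sup>+x. (SUP k. F k x) \<partial>M) \<noteq> \<infinity>" using ennreal_less_top[of "ln A - L"] by (auto simp: top_unique)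
  then have "AE x in M. (SUP k. F k x) \<noteq> \<infinity>" using Fm by (intro nn_integral_noteq_infinite) auto
  then have pos: "AE x in M. h x > 0"
  proof eventually_elim
    case (elim x)
    \<comment> \<open>At a zero of h the function \<open>F k\<close> is at least k because ln A
      \<ge> 0, so the supremum is infinite there.\<close>
    have "h x \<noteq> 0"
    proof
      assume "h x = 0"
      then have "ennreal (real k) \<le> F k x" for k using A(2) by (simp add: F_def max_def ennreal_leI)
      then have "(SUP k. ennreal (real k)) \<le> (SUP k. F k x)" by (intro SUP_mono) auto
      moreover have "(SUP k. ennreal (real k)) = top"
        using ennreal_SUP_of_nat_eq_top by (simp add: ennreal_of_nat_eq_real_of_nat)
      ultimately show False using elim by (simp add: top_unique)
    qed
    then show ?case using nonneg[of x] by simp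
  qed
  have le_SUP: "AE x in M. ennreal (ln A - ln (h x)) \<le> (SUP k. F k x)"
    using pos
  proof eventually_elim
    case (elim x)
    obtain k where "- ln (h x) \<le> real k" using real_arch_simple by blast
    then have "exp (- real k) \<le> exp (ln (h x))" by simp
    then have "max (h x) (exp (- real k)) = h x" using elim by simp
    then have "ennreal (ln A - ln (h x)) = F k x" by (simp add: F_def)
    then show ?case by (auto intro: SUP_upper)
  qed
  have lnle: "AE x in M. ln (h x) \<le> ln A" using pos by eventually_elim (use A in \<open>auto intro: ln_mono\<close>)
  have bound: "(\<integral>\<^sup>+x. ennreal (ln A - ln (h x)) \<partial>M) \<le> ennreal (ln A - L)"
    using nn_integral_mono_AE[OF le_SUP] SUP_le by (rule order_trans)
  have "integrable M (\<lambda>x. ln A - ln (h x))"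
  proof (rule integrableI_nonneg)
    show "AE x in M. 0 \<le> ln A - ln (h x)" using lnle by eventually_elim simp
    show "(\<integral>\<^sup>+x. ennreal (ln A - ln (h x)) \<partial>M) < \<infinity>" using bound ennreal_less_top[of "ln A - L"] by (auto intro: le_less_trans)
  qed auto
  then have "integrable M (\<lambda>x. ln A - (ln A - ln (h x)))" by (rule Bochner_Integration.integrable_diff[rotated]) simp
  then have int: "integrable M (\<lambda>x. ln (h x))" by simp
  \<comment> \<open>\<open>ennreal\<close> sends negative reals to 0; nonnegativity of ln A - L is
    needed to read the bound back as one between reals.\<close>
  have LA: "L \<le> ln A"
  proof -
    have "L \<le> (\<integral>x. ln (max (h x) 1) \<partial>M)" by (rule trunc) simp
    also have "\<dots> \<le> ln A"
    proof -
      have b: "0 \<le> ln (max (h x) 1)" "ln (max (h x) 1) \<le> ln A" for x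
        using A(1)[of x] A(2) by simp_all
      have "AE x in M. norm (ln (max (h x) 1)) \<le> norm (ln A)"
        using b by (intro AE_I2) (auto intro: order_trans[OF _ abs_ge_self])
      then have "integrable M (\<lambda>x. ln (max (h x) 1))"
        by (rule Bochner_Integration.integrable_bound[rotated 2]) simp_all
      then show ?thesis using b by (intro integral_le_const) auto
    qed
    finally show ?thesis .
  qed
  have "ennreal (\<integral>x. ln A - ln (h x) \<partial>M) = (\<integral>\<^sup>+x. ennreal (ln A - ln (h x)) \<partial>M)"
    using int lnle by (intro nn_integral_eq_integral[symmetric]) (auto elim: eventually_mono)
  with bound have "ennreal (\<integral>x. ln A - ln (h x) \<partial>M) \<le> ennreal (ln A - L)" by (simp only:)
  then have "(\<integral>x. ln A - ln (h x) \<partial>M) \<le> ln A - L"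
    using ennreal_le_iff[of "ln A - L"] LA by (simp only: diff_ge_0_iff_ge)
  moreover have "(\<integral>x. ln A - ln (h x) \<partial>M) = ln A - (\<integral>x. ln (h x) \<partial>M)"
    using int by (subst Bochner_Integration.integral_diff) (auto simp: prob_space)
  ultimately show ?thesis by (simp add: log_integral_eq[OF pos int])
qed

end

section \<open>Subadditive potentials on a compact system\<close>

lemma invariant_measures_iff:
  fixes T :: "'a::metric_space \<Rightarrow> 'a"
  assumes T: "continuous_on UNIV T"
  shows "M \<in> invariant_measures T \<longleftrightarrow> invariant_prob M T \<and> sets M = sets borel"
proof -
  have "invariant_prob M T \<longleftrightarrow> prob_space M \<and> distr M borel T = M" if borel: "sets M = sets borel"
  proof -
    have "space M = UNIV" using sets_eq_imp_space_eq[OF borel] by simp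
    moreover have "T \<in> M \<rightarrow>\<^sub>M M"
      using borel_measurable_continuous_onI[OF T] measurable_cong_sets[OF borel borel] by blast
    moreover have "distr M M T = distr M borel T" by (rule distr_cong) (simp_all add: borel)
    ultimately show ?thesis
      by (auto simp: invariant_prob_def invariant_prob_axioms_def)
  qed
  then show ?thesis by (auto simp: invariant_measures_def)
qed

lemma (in invariant_prob) log_integral_funpow:
  assumes "h \<in> borel_measurable M"
  shows "log_integral M (\<lambda>x. h ((T ^^ n) x)) = log_integral M h"
proof -
  have "(\<integral>\<^sup>+x. F (h ((T ^^ n) x)) \<partial>M) = (\<integral>\<^sup>+x. F (h x) \<partial>M)"
    if "F \<in> borel_measurable borel" for F :: "real \<Rightarrow> ennreal"
    using nn_integral_distr[of "T ^^ n" M M "\<lambda>x. F (h x)"] measurable_compose[OF assms that]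
    by (simp only: distr_funpow measurable_funpow)
  from this[of "\<lambda>y. e2ennreal (ereal_log (ereal y))"] this[of "\<lambda>y. e2ennreal (- ereal_log (ereal y))"]
  show ?thesis by (simp add: log_integral_def ereal_integral_def)
qed

locale subadditive_system =
  fixes T :: "'a::metric_space \<Rightarrow> 'a" and \<phi> :: "nat \<Rightarrow> 'a \<Rightarrow> real"
  assumes compact_space: "compact (UNIV :: 'a set)"
    and continuous_T: "continuous_on UNIV T"
    and potential: "subadditive_potential T \<phi>"
    and maximal_exponent: "maximal_lyapunov_exponent \<phi> > -\<infinity>"
begin

definition B :: "nat \<Rightarrow> real" where "B n = (SUP x. \<phi> n x)"

abbreviation \<beta> :: ereal where "\<beta> \<equiv> maximal_lyapunov_exponent \<phi>"

lemma phi_nonneg: "n \<ge> 1 \<Longrightarrow> \<phi> n x \<ge> 0"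
  and phi_continuous: "n \<ge> 1 \<Longrightarrow> continuous_on UNIV (\<phi> n)"
  and phi_sub: "m \<ge> 1 \<Longrightarrow> n \<ge> 1 \<Longrightarrow> \<phi> (m + n) x \<le> \<phi> m x * \<phi> n ((T ^^ m) x)"
  using potential by (auto simp: subadditive_potential_def)

lemma B_attained:
  assumes "n \<ge> 1"
  obtains x where "\<phi> n x = B n" "\<And>y. \<phi> n y \<le> B n"
proof -
  obtain x where x: "\<And>y. \<phi> n y \<le> \<phi> n x"
    using continuous_attains_sup[OF compact_space _ phi_continuous[OF assms]] by auto
  then have eq: "B n = \<phi> n x" unfolding B_def by (intro cSup_eq_maximum) auto
  show thesis by (rule that[of x]) (simp_all add: eq x)
qed

lemma phi_le_B: "n \<ge> 1 \<Longrightarrow> \<phi> n y \<le> B n"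
  using B_attained by blast

lemma B_nonneg: "n \<ge> 1 \<Longrightarrow> B n \<ge> 0"
  using phi_nonneg phi_le_B order_trans by blast

lemma SUP_phi: "n \<ge> 1 \<Longrightarrow> (SUP x. ereal (\<phi> n x)) = ereal (B n)"
proof -
  assume n: "n \<ge> 1"
  then obtain x where x: "\<phi> n x = B n" using B_attained by blast
  show ?thesis
  proof (rule antisym)
    show "(SUP x. ereal (\<phi> n x)) \<le> ereal (B n)" by (rule SUP_least) (simp add: phi_le_B[OF n])
    show "ereal (B n) \<le> (SUP x. ereal (\<phi> n x))" unfolding x[symmetric] by (rule SUP_upper) simp
  qed
qed

lemma B_mult:
  assumes m: "m \<ge> 1" and n: "n \<ge> 1"
  shows "B (m + n) \<le> B m * B n"
proof -
  obtain x where "\<phi> (m + n) x = B (m + n)" using B_attained[of "m + n"] m by auto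
  then have "B (m + n) \<le> \<phi> m x * \<phi> n ((T ^^ m) x)" using phi_sub[OF m n, of x] by simp
  also have "\<dots> \<le> B m * B n"
    by (intro mult_mono phi_le_B B_nonneg phi_nonneg m n)
  finally show ?thesis .
qed

lemma ereal_log_less_top: "ereal_log (ereal x) < \<infinity>"
  by (simp add: ereal_log_def)

text \<open>Fekete's lemma for the submultiplicative maxima \<open>B n\<close>. Being an infimum,
  \<beta> lies below every term; hence \<beta> > -inf excludes \<open>B n = 0\<close>.\<close>

lemma log_B_tendsto: "(\<lambda>n. ereal (1 / real n) * ereal_log (ereal (B n))) \<longlonglongrightarrow> \<beta>"
  and \<beta>_le: "n \<ge> 1 \<Longrightarrow> \<beta> \<le> ereal (1 / real n) * ereal_log (ereal (B n))"
proof -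
  let ?b = "\<lambda>n. ereal (1 / real n) * ereal_log (ereal (B n))"
  have sub: "ereal_log (ereal (B (m + n))) \<le> ereal_log (ereal (B m)) + ereal_log (ereal (B n))"
    if "m \<ge> 1" "n \<ge> 1" for m n
  proof -
    have "ereal_log (ereal (B (m + n))) \<le> ereal_log (ereal (B m * B n))"
      using B_mult[OF that] by (intro ereal_log_mono) auto
    also have "\<dots> \<le> ereal_log (ereal (B m)) + ereal_log (ereal (B n))"
      using B_nonneg[OF that(1)] B_nonneg[OF that(2)]
      by (auto simp: ereal_log_def zero_ereal_def ln_mult mult_le_0_iff)
    finally show ?thesis .
  qed
  have lim: "?b \<longlonglongrightarrow> (INF n\<in>{1..}. ?b n)"
    by (rule fekete_ereal[OF ereal_log_less_top sub])
  have "eventually (\<lambda>n. ereal (1 / real n) * ereal_log (SUP x. ereal (\<phi> n x)) = ?b n) sequentially"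
    by (rule eventually_sequentiallyI[of 1]) (simp add: SUP_phi)
  then have "\<beta> = (INF n\<in>{1..}. ?b n)"
    unfolding maximal_lyapunov_exponent_def using lim by (intro limI) (simp add: tendsto_cong)
  then show "?b \<longlonglongrightarrow> \<beta>" "n \<ge> 1 \<Longrightarrow> \<beta> \<le> ?b n" for n
    using lim by (auto intro: INF_lower)
qed

lemma B_pos:
  assumes "n \<ge> 1"
  shows "B n > 0"
proof (rule ccontr)
  assume "\<not> B n > 0"
  then have "ereal_log (ereal (B n)) = -\<infinity>" by (simp add: ereal_log_def zero_ereal_def)
  then show False using \<beta>_le[OF assms] assms maximal_exponent by auto
qed

lemma \<beta>_real: obtains b where "\<beta> = ereal b"
proof -
  have "\<beta> \<le> ereal (ln (B 1))" using \<beta>_le[of 1] by (simp add: ereal_log_real B_pos)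
  then show thesis using maximal_exponent that by (cases \<beta>) auto
qed

context
  fixes M assumes M: "M \<in> invariant_measures T"
begin

lemma inv: "invariant_prob M T" and borel: "sets M = sets borel"
  using M invariant_measures_iff[OF continuous_T] by auto

lemma phi_measurable: "n \<ge> 1 \<Longrightarrow> \<phi> n \<in> borel_measurable M"
  using borel_measurable_continuous_onI[OF phi_continuous] measurable_cong_sets[OF borel, of borel borel] by blast

lemma log_integral_phi_le: "n \<ge> 1 \<Longrightarrow> log_integral M (\<phi> n) \<le> ereal_log (ereal (B n))"
proof -
  interpret invariant_prob M T by (rule inv)
  show "n \<ge> 1 \<Longrightarrow> log_integral M (\<phi> n) \<le> ereal_log (ereal (B n))"
    by (intro log_integral_le phi_measurable phi_nonneg phi_le_B)
qed

lemma log_integral_phi_subadditive: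
  assumes m: "m \<ge> 1" and n: "n \<ge> 1"
  shows "log_integral M (\<phi> (m + n)) \<le> log_integral M (\<phi> m) + log_integral M (\<phi> n)"
proof -
  interpret invariant_prob M T by (rule inv)
  have mn: "m + n \<ge> 1" using m by simp
  have "log_integral M (\<phi> (m + n)) \<le> log_integral M (\<phi> m) + log_integral M (\<lambda>x. \<phi> n ((T ^^ m) x))"
    by (rule log_integral_mult_le[OF phi_measurable[OF m] measurable_compose[OF measurable_funpow phi_measurable[OF n]]
        phi_measurable[OF mn] phi_nonneg[OF m] phi_le_B[OF m] phi_nonneg[OF n] phi_le_B[OF n]
        phi_nonneg[OF mn] phi_le_B[OF mn] phi_sub[OF m n]])
  then show ?thesis by (simp add: log_integral_funpow phi_measurable[OF n])
qed

text \<open>The infimum form gives a bound at each fixed n. It makes all ln (\<phi> n x) integrable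
  once the exponent is finite, and it is the form in which the exponent can be tested on weak*
  neighbourhoods.\<close>

lemma log_integral_phi_tendsto: "(\<lambda>n. ereal (1 / real n) * log_integral M (\<phi> n)) \<longlonglongrightarrow> lyapunov_exponent M \<phi>"
  and exponent_le: "n \<ge> 1 \<Longrightarrow> lyapunov_exponent M \<phi> \<le> ereal (1 / real n) * log_integral M (\<phi> n)"
proof -
  have fin: "log_integral M (\<phi> n) < \<infinity>" if "n \<ge> 1" for n
    using log_integral_phi_le[OF that] ereal_log_less_top by (rule le_less_trans)
  have lim: "(\<lambda>n. ereal (1 / real n) * log_integral M (\<phi> n)) \<longlonglongrightarrow> (INF n\<in>{1..}. ereal (1 / real n) * log_integral M (\<phi> n))"
    by (rule fekete_ereal[OF fin log_integral_phi_subadditive])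
  then have "lyapunov_exponent M \<phi> = (INF n\<in>{1..}. ereal (1 / real n) * log_integral M (\<phi> n))"
    unfolding lyapunov_exponent_def log_integral_def by (rule limI)
  then show "(\<lambda>n. ereal (1 / real n) * log_integral M (\<phi> n)) \<longlonglongrightarrow> lyapunov_exponent M \<phi>"
    "n \<ge> 1 \<Longrightarrow> lyapunov_exponent M \<phi> \<le> ereal (1 / real n) * log_integral M (\<phi> n)" for n
    using lim by (auto intro: INF_lower)
qed

lemma exponent_le_\<beta>: "lyapunov_exponent M \<phi> \<le> \<beta>"
  using log_integral_phi_le by (intro LIMSEQ_le[OF log_integral_phi_tendsto log_B_tendsto] exI[of _ 1]) (auto intro: ereal_mult_left_mono)

lemma log_integral_phi_finite:
  assumes "lyapunov_exponent M \<phi> > -\<infinity>" "n \<ge> 1"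
  shows "(AE x in M. \<phi> n x > 0) \<and> integrable M (\<lambda>x. ln (\<phi> n x)) \<and> log_integral M (\<phi> n) = ereal (\<integral>x. ln (\<phi> n x) \<partial>M)"
proof -
  interpret invariant_prob M T by (rule inv)
  have "log_integral M (\<phi> n) \<noteq> -\<infinity>" using exponent_le[OF assms(2)] assms by auto
  note * = log_integral_neq_MInf[OF phi_measurable[OF assms(2)] phi_nonneg[OF assms(2)] phi_le_B[OF assms(2)] this]
  show ?thesis using * log_integral_eq[OF *] by blast
qed

text \<open>The one-cell partition shows that the supremum is not taken over an empty
  family.\<close>

lemma entropy_gt_MInf: "ks_entropy T M > -\<infinity>"
proof -
  have "space M = UNIV" using sets_eq_imp_space_eq[OF borel] by simp
  then have "{UNIV} \<in> {P. finite P \<and> P \<subseteq> sets M \<and> partition_on (space M) P}"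
    using sets.top[of M] by (auto simp: partition_on_def disjoint_def)
  then have "ereal (partition_entropy_rate T M {UNIV}) \<le> ks_entropy T M"
    unfolding ks_entropy_def by (rule SUP_upper)
  then show ?thesis by auto
qed

text \<open>One half of the variational principle for t\<Phi>. Since the exponent is real, t c can
  be moved to the right before the supremum over partitions is taken.\<close>

lemma free_energy_le_pressure:
  assumes t: "t > 0" and \<chi>: "lyapunov_exponent M \<phi> = ereal c"
  shows "ks_entropy T M + ereal (t * c) \<le> pressure T (scaled_potential t \<phi>)"
proof -
  interpret invariant_prob M T by (rule inv)
  have fin: "(AE x in M. \<phi> n x > 0)" "integrable M (\<lambda>x. ln (\<phi> n x))" "log_integral M (\<phi> n) = ereal (\<integral>x. ln (\<phi> n x) \<partial>M)"
    if "n \<ge> 1" for n using log_integral_phi_finite[OF _ that] \<chi> by auto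
  let ?\<psi> = "scaled_potential t \<phi>"
  \<comment> \<open>At a zero of \<open>\<phi> n\<close> both sides are 0, by
    \<open>0 powr t = 0\<close> and \<open>ln 0 = 0\<close>.\<close>
  have ln_eq: "ln (?\<psi> n x) = t * ln (\<phi> n x)" for n x
    by (cases "\<phi> n x = 0") (simp_all add: scaled_potential_def ln_powr)
  have "(\<lambda>n. ereal (1 / real n) * log_integral M (\<phi> n)) \<longlonglongrightarrow> ereal c" using log_integral_phi_tendsto \<chi> by simp
  moreover have "eventually (\<lambda>n. ereal (1 / real n) * log_integral M (\<phi> n) = ereal ((\<integral>x. ln (\<phi> n x) \<partial>M) / real n)) sequentially"
    by (rule eventually_sequentiallyI[of 1]) (simp add: fin)
  ultimately have "(\<lambda>n. (\<integral>x. ln (\<phi> n x) \<partial>M) / real n) \<longlonglongrightarrow> c"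
    by (simp add: tendsto_cong)
  then have "(\<lambda>n. t * ((\<integral>x. ln (\<phi> n x) \<partial>M) / real n)) \<longlonglongrightarrow> t * c" by (intro tendsto_intros)
  then have lim: "(\<lambda>n. (\<integral>x. ln (?\<psi> n x) \<partial>M) / real n) \<longlonglongrightarrow> t * c"
    by (simp add: ln_eq)
  have rate: "ereal (partition_entropy_rate T M P + t * c) \<le> pressure T ?\<psi>"
    if P: "finite P" "P \<subseteq> sets M" "partition_on (space M) P" for P
  proof -
    obtain g :: "'a \<Rightarrow> 'a set" where g: "simple_function M g"
      "\<And>n. partition_entropy M (iterated_join T P n) = shannon M (itinerary T g n)"
      using partition_entropy_iterated_join[OF P(1,2)] P(3) by auto
    show ?thesis
      unfolding partition_entropy_rate_def g(2)
    proof (rule entropy_rate_plus_exponent_le_pressure[OF compact_space inv borel g(1) _ _ _ lim])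
      fix n :: nat assume n: "n \<ge> 1"
      show "?\<psi> n x \<ge> 0" for x by (simp add: scaled_potential_def)
      show "AE x in M. ?\<psi> n x > 0" using fin(1)[OF n] by eventually_elim (simp add: scaled_potential_def)
      show "integrable M (\<lambda>x. ln (?\<psi> n x))" using fin(2)[OF n] by (simp add: ln_eq)
    qed
  qed
  have "ks_entropy T M \<le> pressure T ?\<psi> - ereal (t * c)"
    unfolding ks_entropy_def
  proof (rule SUP_least)
    fix P assume "P \<in> {P. finite P \<and> P \<subseteq> sets M \<and> partition_on (space M) P}"
    then show "ereal (partition_entropy_rate T M P) \<le> pressure T ?\<psi> - ereal (t * c)"
      using rate[of P] by (cases "pressure T ?\<psi>") auto
  qed
  then show ?thesis by (cases "ks_entropy T M"; cases "pressure T ?\<psi>") auto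
qed

end

lemma pressure_ge:
  assumes t: "t > 0"
  shows "ereal t * \<beta> \<le> pressure T (scaled_potential t \<phi>)"
proof -
  let ?Z = "\<lambda>n. ereal (1 / real n) * ereal_log (separated_sum T (scaled_potential t \<phi>) 1 n)"
  have "ereal t * (ereal (1 / real n) * ereal_log (ereal (B n))) \<le> ?Z n" if n: "n \<ge> 1" for n
  proof -
    obtain x where x: "\<phi> n x = B n" using B_attained[OF n] by blast
    have "ereal t * ereal_log (ereal (B n)) = ereal_log (ereal (\<Sum>x\<in>{x}. scaled_potential t \<phi> n x))"
      using t B_nonneg[OF n] by (simp add: ereal_log_powr scaled_potential_def x)
    also have "\<dots> \<le> ereal_log (separated_sum T (scaled_potential t \<phi>) 1 n)"
      unfolding separated_sum_def by (intro ereal_log_mono SUP_upper) (auto simp: separated_def)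
    finally have "ereal (1 / real n) * (ereal t * ereal_log (ereal (B n))) \<le> ?Z n"
      by (intro ereal_mult_left_mono) auto
    then show ?thesis by (simp add: mult.left_commute)
  qed
  then have ev: "eventually (\<lambda>n. ereal t * (ereal (1 / real n) * ereal_log (ereal (B n))) \<le> ?Z n) sequentially"
    by (rule eventually_sequentiallyI)
  have "(\<lambda>n. ereal t * (ereal (1 / real n) * ereal_log (ereal (B n)))) \<longlonglongrightarrow> ereal t * \<beta>"
    by (intro tendsto_cmult_ereal log_B_tendsto) simp
  then have "ereal t * \<beta> = limsup (\<lambda>n. ereal t * (ereal (1 / real n) * ereal_log (ereal (B n))))"
    by (intro lim_imp_Limsup[symmetric]) auto
  also have "\<dots> \<le> limsup ?Z" by (rule Limsup_mono[OF ev])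
  also have "\<dots> \<le> pressure T (scaled_potential t \<phi>)"
    unfolding pressure_eq_SUP pressure_at_scale_def[symmetric] by (intro SUP_upper) auto
  finally show ?thesis .
qed

lemma B_le_power: "n \<ge> 1 \<Longrightarrow> B n \<le> B 1 ^ n"
proof (induction n rule: nat_induct_at_least)
  case (Suc n)
  have "B (n + 1) \<le> B n * B 1" using Suc.hyps by (intro B_mult) auto
  also have "\<dots> \<le> B 1 ^ n * B 1" using Suc.IH B_nonneg[of 1] by (intro mult_right_mono) auto
  finally show ?case by (simp add: mult.commute)
qed simp

text \<open>The crude estimate \<phi> n \<le> (B 1)^n takes the weights out of the sum and leaves
  the sum that counts separated points. It serves to make P(t) finite.\<close>

lemma pressure_le:
  assumes t: "t > 0"
  shows "pressure T (scaled_potential t \<phi>) \<le> ereal (t * ln (B 1)) + topological_entropy T"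
proof -
  define c where "c = t * ln (B 1)"
  have scale: "pressure_at_scale T (scaled_potential t \<phi>) \<epsilon> \<le> ereal c + pressure_at_scale T (\<lambda>n x. 1) \<epsilon>" for \<epsilon>
  proof -
    let ?X = "\<lambda>n. ereal (1 / real n) * ereal_log (separated_sum T (\<lambda>n x. 1) \<epsilon> n)"
    have "ereal (1 / real n) * ereal_log (separated_sum T (scaled_potential t \<phi>) \<epsilon> n) \<le> ereal c + ?X n"
      if n: "n \<ge> 1" for n
    proof -
      let ?S = "separated_sum T (\<lambda>n x. 1) \<epsilon> n"
      \<comment> \<open>The empty separated set makes the supremum nonnegative, so that the extended
        logarithm of the product below splits.\<close>
      have "ereal (\<Sum>x\<in>({} :: 'a set). 1) \<le> ?S"
        unfolding separated_sum_def by (rule SUP_upper) (simp add: separated_def)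
      then have S: "0 \<le> ?S" by (simp add: zero_ereal_def)
      have "scaled_potential t \<phi> n x \<le> exp (real n * c)" for x
      proof -
        have "\<phi> n x powr t \<le> (B 1 ^ n) powr t"
          using phi_nonneg[OF n] phi_le_B[OF n] B_le_power[OF n] t by (intro powr_mono2) (auto intro: order_trans)
        also have "\<dots> = exp (real n * c)"
          using B_pos[of 1] by (simp add: powr_def c_def ln_realpow)
        finally show ?thesis by (simp add: scaled_potential_def)
      qed
      then have le: "(\<Sum>x\<in>E. scaled_potential t \<phi> n x) \<le> exp (real n * c) * (\<Sum>x\<in>E. 1)" for E :: "'a set"
        by (simp add: sum_distrib_left del: sum_constant) (intro sum_mono)
      have "separated_sum T (scaled_potential t \<phi>) \<epsilon> n \<le> ereal (exp (real n * c)) * ?S"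
        unfolding separated_sum_def[of T "scaled_potential t \<phi>"]
      proof (rule SUP_least)
        fix E :: "'a set" assume E: "E \<in> {E. finite E \<and> separated T n \<epsilon> E}"
        have "ereal (\<Sum>x\<in>E. scaled_potential t \<phi> n x) \<le> ereal (exp (real n * c)) * ereal (\<Sum>x\<in>E. 1)"
          using le[of E] by simp
        also have "\<dots> \<le> ereal (exp (real n * c)) * ?S"
          unfolding separated_sum_def using E by (intro ereal_mult_left_mono SUP_upper) auto
        finally show "ereal (\<Sum>x\<in>E. scaled_potential t \<phi> n x) \<le> ereal (exp (real n * c)) * ?S" .
      qed
      then have "ereal_log (separated_sum T (scaled_potential t \<phi>) \<epsilon> n) \<le> ereal_log (ereal (exp (real n * c)) * ?S)"
        by (rule ereal_log_mono)
      also have "\<dots> = ereal (real n * c) + ereal_log ?S"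
        using ereal_log_mult[OF exp_gt_zero S] by simp
      finally have "ereal (1 / real n) * ereal_log (separated_sum T (scaled_potential t \<phi>) \<epsilon> n)
          \<le> ereal (1 / real n) * (ereal (real n * c) + ereal_log ?S)"
        by (intro ereal_mult_left_mono) auto
      also have "\<dots> = ereal c + ?X n" using n by (cases "ereal_log ?S") (auto simp: field_simps)
      finally show ?thesis .
    qed
    then have ev: "eventually (\<lambda>n. ereal (1 / real n) * ereal_log (separated_sum T (scaled_potential t \<phi>) \<epsilon> n) \<le> ereal c + ?X n) sequentially"
      by (rule eventually_sequentiallyI)
    show ?thesis
      unfolding pressure_at_scale_def
      using Limsup_mono[OF ev] Limsup_add_ereal_left[of sequentially "ereal c" ?X] by simp
  qed
  show ?thesis
    unfolding topological_entropy_def pressure_eq_SUP[of T "scaled_potential t \<phi>"]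
  proof (rule SUP_least)
    fix \<epsilon> :: real assume \<epsilon>: "\<epsilon> \<in> {0<..}"
    have "pressure_at_scale T (\<lambda>n x. 1) \<epsilon> \<le> pressure T (\<lambda>n x. 1)"
      unfolding pressure_eq_SUP using \<epsilon> by (rule SUP_upper)
    then show "pressure_at_scale T (scaled_potential t \<phi>) \<epsilon> \<le> ereal (t * ln (B 1)) + pressure T (\<lambda>n x. 1)"
      using scale[of \<epsilon>] by (auto simp: c_def intro: order_trans add_left_mono)
  qed
qed

end

section \<open>Zero-temperature limits\<close>

lemma openin_weak_star:
  fixes T :: "'a::metric_space \<Rightarrow> 'a" and f :: "'a \<Rightarrow> real"
  assumes "continuous_on UNIV f" "open U"
  shows "openin (weak_star_topology T) {\<mu> \<in> invariant_measures T. (\<integral>x. f x \<partial>\<mu>) \<in> U}"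
  unfolding weak_star_topology_def using assms by (intro topology_generated_by_Basis) blast

lemma topspace_weak_star: "topspace (weak_star_topology T) \<subseteq> invariant_measures T"
  unfolding weak_star_topology_def by auto

context subadditive_system begin

text \<open>The logarithm of \<open>\<phi> n\<close> may be unbounded below and is no test function,
  but ln (max (\<phi> n) \<delta>) is one, and its integral dominates n X t. With n and \<delta>
  fixed, t is taken to infinity; then \<delta> is removed, and n goes last.\<close>

lemma exponent_accumulation_ge:
  assumes m: "\<And>t. t > 0 \<Longrightarrow> m t \<in> invariant_measures T"
    and acc: "accumulation_point_at_top (weak_star_topology T) m \<mu>"
    and X: "\<And>t. t > 0 \<Longrightarrow> lyapunov_exponent (m t) \<phi> = ereal (X t)"
    and lim: "(X \<longlongrightarrow> b) at_top"
  shows "ereal b \<le> lyapunov_exponent \<mu> \<phi>"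
proof -
  have \<mu>: "\<mu> \<in> invariant_measures T"
    using acc topspace_weak_star by (auto simp: accumulation_point_at_top_def)
  interpret \<mu>: invariant_prob \<mu> T by (rule inv[OF \<mu>])
  have "ereal (real n * b) \<le> log_integral \<mu> (\<phi> n)" if n: "n \<ge> 1" for n
  proof (rule \<mu>.log_integral_ge_truncations[OF phi_measurable[OF \<mu> n] phi_nonneg[OF n] phi_le_B[OF n]])
    fix \<delta> :: real assume \<delta>: "\<delta> > 0"
    define f where "f x = ln (max (\<phi> n x) \<delta>)" for x
    have f: "continuous_on UNIV f"
      unfolding f_def using \<delta> by (intro continuous_intros phi_continuous n) (auto simp: less_max_iff_disj max_def)
    have X_le: "real n * X t \<le> (\<integral>x. f x \<partial>m t)" if t: "t > 0" for t
    proof -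
      interpret mt: invariant_prob "m t" T by (rule inv[OF m[OF t]])
      have fin: "AE x in m t. \<phi> n x > 0" "integrable (m t) (\<lambda>x. ln (\<phi> n x))" "log_integral (m t) (\<phi> n) = ereal (\<integral>x. ln (\<phi> n x) \<partial>m t)"
        using log_integral_phi_finite[OF m[OF t] _ n] X[OF t] by auto
      have "ereal (X t) \<le> ereal (1 / real n) * ereal (\<integral>x. ln (\<phi> n x) \<partial>m t)"
        using exponent_le[OF m[OF t] n] X[OF t] fin(3) by simp
      then have "real n * X t \<le> (\<integral>x. ln (\<phi> n x) \<partial>m t)" using n by (simp add: field_simps)
      also have "\<dots> \<le> (\<integral>x. f x \<partial>m t)"
      proof (rule integral_mono_AE[OF fin(2)])
        have "f \<in> borel_measurable (m t)"
          using borel_measurable_continuous_onI[OF f] measurable_cong_sets[OF borel[OF m[OF t]], of borel borel] by blast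
        moreover have "\<bar>f x\<bar> \<le> \<bar>ln \<delta>\<bar> + \<bar>ln (max (B n) \<delta>)\<bar>" for x
        proof -
          have "ln \<delta> \<le> f x" "f x \<le> ln (max (B n) \<delta>)"
            unfolding f_def using \<delta> phi_le_B[OF n, of x] by (intro ln_mono; auto simp: less_max_iff_disj)+
          then show ?thesis by linarith
        qed
        ultimately show "integrable (m t) f" by (intro mt.integrable_const_bound[of _ "\<bar>ln \<delta>\<bar> + \<bar>ln (max (B n) \<delta>)\<bar>"]) auto
        show "AE x in m t. ln (\<phi> n x) \<le> f x"
          using fin(1) by eventually_elim (auto simp: f_def intro: ln_mono)
      qed
      finally show ?thesis .
    qed
    have "real n * b \<le> (\<integral>x. f x \<partial>\<mu>) + e" if e: "e > 0" for e
    proof -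
      \<comment> \<open>Half of e is spent on this neighbourhood and half on the convergence of X.
        The first holds for arbitrarily large t and the second eventually, so some t satisfies
        both.\<close>
      let ?U = "{\<nu> \<in> invariant_measures T. (\<integral>x. f x \<partial>\<nu>) \<in> {..<(\<integral>x. f x \<partial>\<mu>) + e / 2}}"
      have "openin (weak_star_topology T) ?U" by (intro openin_weak_star f) simp
      moreover have "\<mu> \<in> ?U" using \<mu> e by simp
      ultimately have fr: "\<exists>\<^sub>F t in at_top. m t \<in> ?U"
        using acc by (auto simp: accumulation_point_at_top_def)
      have "((\<lambda>t. real n * X t) \<longlongrightarrow> real n * b) at_top" by (intro tendsto_intros lim)
      then have "eventually (\<lambda>t. real n * b - e / 2 < real n * X t) at_top"
        using e by (intro order_tendstoD(1)) auto
      then have "eventually (\<lambda>t. t > 0 \<and> real n * b - e / 2 < real n * X t) at_top"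
        using eventually_gt_at_top[of 0] by eventually_elim simp
      from frequently_ex[OF frequently_eventually_conj[OF fr this]]
      obtain t where t: "t > 0" "m t \<in> ?U" "real n * b - e / 2 < real n * X t"
        by (elim exE conjE)
      then show ?thesis using X_le[OF t(1)] by simp
    qed
    then show "real n * b \<le> (\<integral>x. ln (max (\<phi> n x) \<delta>) \<partial>\<mu>)"
      unfolding f_def[symmetric] by (rule field_le_epsilon)
  qed
  then have "ereal b \<le> ereal (1 / real n) * log_integral \<mu> (\<phi> n)" if "n \<ge> 1" for n
  proof -
    have "ereal (1 / real n) * ereal (real n * b) \<le> ereal (1 / real n) * log_integral \<mu> (\<phi> n)"
      using \<open>\<And>n. n \<ge> 1 \<Longrightarrow> ereal (real n * b) \<le> log_integral \<mu> (\<phi> n)\<close>[OF that] by (intro ereal_mult_left_mono) auto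
    then show ?thesis using that by simp
  qed
  then show ?thesis by (intro LIMSEQ_le_const[OF log_integral_phi_tendsto[OF \<mu>]]) blast
qed

text \<open>The pressure is real, the entropy is not -inf and the exponent is not inf. A real sum
  then forces both terms to be real; the mixed case is also excluded, because inf + (-inf) = inf in
  \<open>ereal\<close>.\<close>

lemma equilibrium_finite:
  assumes "topological_entropy T < \<infinity>" and t: "t > 0" and eq: "equilibrium_measure T \<phi> t \<nu>"
  obtains h x where "ks_entropy T \<nu> = ereal h" "lyapunov_exponent \<nu> \<phi> = ereal x"
    "pressure T (scaled_potential t \<phi>) = ereal (h + t * x)"
proof -
  have \<nu>: "\<nu> \<in> invariant_measures T" and sum: "ks_entropy T \<nu> + ereal t * lyapunov_exponent \<nu> \<phi> = pressure T (scaled_potential t \<phi>)"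
    using eq by (auto simp: equilibrium_measure_def)
  obtain b where b: "\<beta> = ereal b" by (rule \<beta>_real)
  have "pressure T (scaled_potential t \<phi>) < \<infinity>"
    using pressure_le[OF t] assms(1) by (cases "topological_entropy T") (auto intro: le_less_trans)
  moreover have "pressure T (scaled_potential t \<phi>) > -\<infinity>"
    using pressure_ge[OF t] b by (auto intro: less_le_trans)
  ultimately obtain p where p: "pressure T (scaled_potential t \<phi>) = ereal p"
    by (cases "pressure T (scaled_potential t \<phi>)") auto
  have "ks_entropy T \<nu> \<noteq> -\<infinity>" using entropy_gt_MInf[OF \<nu>] by auto
  moreover have "lyapunov_exponent \<nu> \<phi> \<noteq> \<infinity>" using exponent_le_\<beta>[OF \<nu>] b by auto
  ultimately show thesis
    using sum t p by (cases "ks_entropy T \<nu>"; cases "lyapunov_exponent \<nu> \<phi>") (auto intro: that)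
qed

end

theorem theorem1p1:
  fixes T :: "'a::metric_space \<Rightarrow> 'a"
    and \<phi> :: "nat \<Rightarrow> 'a \<Rightarrow> real"
    and m :: "real \<Rightarrow> 'a measure"
  assumes "compact (UNIV :: 'a set)"
    and "continuous_on UNIV T"
    and "upper_semicontinuous_map (weak_star_topology T) (ks_entropy T)"
    and "topological_entropy T < \<infinity>"
    and "subadditive_potential T \<phi>"
    and "maximal_lyapunov_exponent \<phi> > -\<infinity>"
    and "\<And>t. t > 0 \<Longrightarrow> equilibrium_measure T \<phi> t (m t)"
  shows "(\<forall>\<mu>. accumulation_point_at_top (weak_star_topology T) m \<mu> \<longrightarrow>
            \<mu> \<in> maximizing_measures T \<phi> \<and>
            ((\<lambda>t. lyapunov_exponent (m t) \<phi>) \<longlongrightarrow> lyapunov_exponent \<mu> \<phi>) at_top \<and>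
            ((\<lambda>t. ks_entropy T (m t)) \<longlongrightarrow> ks_entropy T \<mu>) at_top \<and>
            (\<exists>\<nu>\<in>maximizing_measures T \<phi>. ks_entropy T \<nu> = ks_entropy T \<mu>) \<and>
            (\<forall>\<nu>\<in>maximizing_measures T \<phi>. ks_entropy T \<nu> \<le> ks_entropy T \<mu>)) \<and>
         (\<forall>\<epsilon>::real. \<epsilon> > 0 \<longrightarrow>
            (\<exists>t>0. \<exists>\<nu>. equilibrium_measure T \<phi> t \<nu> \<and>
               \<bar>lyapunov_exponent \<nu> \<phi> - maximal_lyapunov_exponent \<phi>\<bar> < ereal \<epsilon>))"
proof -
  interpret subadditive_system T \<phi> by unfold_locales fact+
  obtain b where b: "\<beta> = ereal b" by (rule \<beta>_real)
  have m: "m t \<in> invariant_measures T" if "t > 0" for t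
    using assms(7)[OF that] by (simp add: equilibrium_measure_def)
  have "\<forall>t. \<exists>h x. t > 0 \<longrightarrow> ks_entropy T (m t) = ereal h \<and> lyapunov_exponent (m t) \<phi> = ereal x \<and>
      pressure T (scaled_potential t \<phi>) = ereal (h + t * x)"
    using equilibrium_finite[OF assms(4) _ assms(7)] by metis
  then obtain H X where HX: "\<And>t. t > 0 \<Longrightarrow> ks_entropy T (m t) = ereal (H t)"
    "\<And>t. t > 0 \<Longrightarrow> lyapunov_exponent (m t) \<phi> = ereal (X t)"
    "\<And>t. t > 0 \<Longrightarrow> pressure T (scaled_potential t \<phi>) = ereal (H t + t * X t)"
    by metis
  have X_le: "X t \<le> b" if "t > 0" for t
    using exponent_le_\<beta>[OF m[OF that]] that by (simp add: HX b)
  have compare: "H s + t * X s \<le> H t + t * X t" if "s > 0" "t > 0" for s t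
    using free_energy_le_pressure[OF m[OF that(1)] that(2) HX(2)[OF that(1)]] that by (simp add: HX)
  have H_antimono: "H t \<le> H s" if "0 < s" "s \<le> t" for s t
  proof -
    \<comment> \<open>Adding the two comparisons cancels the entropies, so X is nondecreasing. In
      the comparison at parameter s, the larger exponent of \<open>m t\<close> must then be paid for
      by a smaller entropy.\<close>
    have "(t - s) * (X t - X s) \<ge> 0"
      using compare[of s t] compare[of t s] that by (simp add: algebra_simps)
    then have "s = t \<or> X t \<ge> X s" using that by (auto simp: zero_le_mult_iff)
    then have "s * X s \<le> s * X t" using that by auto
    then show ?thesis using compare[of t s] that by linarith
  qed
  have X_lim: "(X \<longlongrightarrow> b) at_top"
  proof (rule tendsto_sandwich)
    show "eventually (\<lambda>t. b - H 1 * inverse t \<le> X t) at_top"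
      using eventually_ge_at_top[of 1]
    proof eventually_elim
      case (elim t)
      have "t * b \<le> H t + t * X t" using pressure_ge[of t] elim by (simp add: HX b)
      then have "t * b \<le> H 1 + t * X t" using H_antimono[of 1 t] elim by simp
      then show ?case using elim by (simp add: field_simps)
    qed
    show "eventually (\<lambda>t. X t \<le> b) at_top"
      using eventually_gt_at_top[of 0] by eventually_elim (rule X_le)
    have "((\<lambda>t. b - H 1 * inverse t) \<longlongrightarrow> b - H 1 * 0) at_top"
      by (intro tendsto_intros tendsto_inverse_0_at_top filterlim_ident)
    then show "((\<lambda>t. b - H 1 * inverse t) \<longlongrightarrow> b) at_top" by simp
  qed simp
  have H_ge: "ks_entropy T \<nu> \<le> ereal (H t)" if \<nu>: "\<nu> \<in> maximizing_measures T \<phi>" and t: "t > 0" for \<nu> t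
  proof -
    have "\<nu> \<in> invariant_measures T" "lyapunov_exponent \<nu> \<phi> = ereal b"
      using \<nu> b by (auto simp: maximizing_measures_def)
    then have "ks_entropy T \<nu> + ereal (t * b) \<le> ereal (H t + t * X t)"
      using free_energy_le_pressure[OF _ t] HX(3)[OF t] by metis
    also have "\<dots> \<le> ereal (H t + t * b)" using X_le[OF t] t by simp
    finally show ?thesis by (cases "ks_entropy T \<nu>") auto
  qed
  have acc: "\<mu> \<in> maximizing_measures T \<phi> \<and>
      ((\<lambda>t. lyapunov_exponent (m t) \<phi>) \<longlongrightarrow> lyapunov_exponent \<mu> \<phi>) at_top \<and>
      ((\<lambda>t. ks_entropy T (m t)) \<longlongrightarrow> ks_entropy T \<mu>) at_top \<and>
      (\<exists>\<nu>\<in>maximizing_measures T \<phi>. ks_entropy T \<nu> = ks_entropy T \<mu>) \<and>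
      (\<forall>\<nu>\<in>maximizing_measures T \<phi>. ks_entropy T \<nu> \<le> ks_entropy T \<mu>)"
    if acc: "accumulation_point_at_top (weak_star_topology T) m \<mu>" for \<mu>
  proof (intro conjI)
    have top: "\<mu> \<in> topspace (weak_star_topology T)" using acc by (simp add: accumulation_point_at_top_def)
    then have \<mu>: "\<mu> \<in> invariant_measures T" using topspace_weak_star by auto
    have "ereal b \<le> lyapunov_exponent \<mu> \<phi>" by (rule exponent_accumulation_ge[OF m acc HX(2) X_lim])
    then have \<chi>: "lyapunov_exponent \<mu> \<phi> = ereal b" using exponent_le_\<beta>[OF \<mu>] b by simp
    show max: "\<mu> \<in> maximizing_measures T \<phi>" using \<mu> \<chi> b by (simp add: maximizing_measures_def)
    have ev: "eventually (\<lambda>t. lyapunov_exponent (m t) \<phi> = ereal (X t)) at_top"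
      using eventually_gt_at_top[of 0] by eventually_elim (rule HX)
    show "((\<lambda>t. lyapunov_exponent (m t) \<phi>) \<longlongrightarrow> lyapunov_exponent \<mu> \<phi>) at_top"
      unfolding \<chi> tendsto_cong[OF ev] by (simp add: X_lim)
    show lim: "((\<lambda>t. ks_entropy T (m t)) \<longlongrightarrow> ks_entropy T \<mu>) at_top"
    proof (rule order_tendstoI)
      \<comment> \<open>Since \<mu> is itself maximizing, \<open>H_ge\<close> bounds its entropy by
        that of every \<open>m t\<close>; this direction uses no semicontinuity.\<close>
      fix l assume l: "l < ks_entropy T \<mu>"
      show "eventually (\<lambda>t. l < ks_entropy T (m t)) at_top"
        using eventually_gt_at_top[of 0]
        by eventually_elim (use H_ge[OF max] l in \<open>simp add: HX less_le_trans\<close>)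
    next
      fix u assume u: "ks_entropy T \<mu> < u"
      let ?U = "{\<nu> \<in> topspace (weak_star_topology T). ks_entropy T \<nu> < u}"
      have "openin (weak_star_topology T) ?U" using assms(3) by (simp add: upper_semicontinuous_map_def)
      then have fr: "\<exists>\<^sub>F t in at_top. m t \<in> ?U"
        using acc top u by (auto simp: accumulation_point_at_top_def)
      from frequently_ex[OF frequently_eventually_conj[OF this eventually_gt_at_top[of 0]]]
      obtain s where s: "s > 0" "ks_entropy T (m s) < u" by auto
      show "eventually (\<lambda>t. ks_entropy T (m t) < u) at_top"
        using eventually_ge_at_top[of s]
      proof eventually_elim
        case (elim t)
        then have "ks_entropy T (m t) \<le> ks_entropy T (m s)" using H_antimono[OF s(1) elim] s(1) by (simp add: HX)
        then show ?case using s(2) by (rule le_less_trans)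
      qed
    qed
    show "\<exists>\<nu>\<in>maximizing_measures T \<phi>. ks_entropy T \<nu> = ks_entropy T \<mu>" using max by blast
    show "\<forall>\<nu>\<in>maximizing_measures T \<phi>. ks_entropy T \<nu> \<le> ks_entropy T \<mu>"
    proof
      fix \<nu> assume \<nu>: "\<nu> \<in> maximizing_measures T \<phi>"
      have "eventually (\<lambda>t. ks_entropy T \<nu> \<le> ks_entropy T (m t)) at_top"
        using eventually_gt_at_top[of 0] by eventually_elim (use H_ge[OF \<nu>] in \<open>simp add: HX\<close>)
      then show "ks_entropy T \<nu> \<le> ks_entropy T \<mu>"
        using lim by (intro tendsto_lowerbound) auto
    qed
  qed
  have approx: "\<exists>t>0. \<exists>\<nu>. equilibrium_measure T \<phi> t \<nu> \<and> \<bar>lyapunov_exponent \<nu> \<phi> - \<beta>\<bar> < ereal \<epsilon>"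
    if "\<epsilon> > 0" for \<epsilon> :: real
  proof -
    have "eventually (\<lambda>t. dist (X t) b < \<epsilon>) at_top" using tendstoD[OF X_lim that] .
    then have "eventually (\<lambda>t. t > 0 \<and> dist (X t) b < \<epsilon>) at_top"
      using eventually_gt_at_top[of 0] by eventually_elim simp
    then obtain t where t: "t > 0" "dist (X t) b < \<epsilon>"
      using eventually_happens[of _ "at_top :: real filter"] by auto
    then have "\<bar>lyapunov_exponent (m t) \<phi> - \<beta>\<bar> < ereal \<epsilon>" by (simp add: HX b dist_real_def)
    then show ?thesis using t(1) assms(7) by blast
  qed
  show ?thesis using acc approx by blast
qed

end
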